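(* For every integer $d\ge 2$, the self-similar frog model $\mathrm{SFM}\left(d, \frac{d-1}{2d-1}\right)$ is recurrent.
   Context: Let $\mathbb{T}_d$ be the infinite rooted $d$-ary tree: every vertex has $d$ children, and every vertex other than the root $\varnothing$ has one parent. Non-backtracking frog model $\mathrm{nbFM}(d,p)$, $p\in[0,1]$: discrete time; at time $0$ there is one sleeping frog at each non-root vertex and one active frog at the root. When an active frog visits a vertex with a sleeping frog, that frog wakes up and starts moving. The paths of active frogs are non-backtracking (a frog never returns to a site it has previously visited), and active frogs are killed upon visiting the root. The frog initially active at the root moves at every step to a uniformly chosen child. Any other frog, upon waking, makes its first step to its parent with probability $p$, or otherwise (with probability $1-p$) to a uniformly chosen child. Afterwards: (i) if the last step was upward (and the frog is not at the root, where it is killed), the next step is upward with probability $\frac{p}{p+(1-p)(d-1)/d}$, and otherwise downward to one of the $d-1$ children other than the one it just came from, equally likely; (ii) if the last step was downward, the next step is downward to a uniformly chosen child. Different frogs make independent choices. Consequently only one child of the root, denoted $\varnothing'$, is ever visited. Self-similar frog model $\mathrm{SFM}(d,p)$: $\mathrm{nbFM}(d,p)$ modified as follows. For every vertex $u\neq\varnothing$ and every child $v$ of $u$, once $v$ has been visited for the first time (necessarily by a jump from $u$), any frog that later attempts to jump from $u$ to $v$ is killed; if several frogs attempt the first jump from $u$ to $v$ simultaneously, exactly one of them survives. Thus the subtree rooted at any such $v$ is entered from outside at most once, and, conditionally on $v$ being visited, the process restricted to that subtree (together with $u$, which plays the role of the root) is a time-shifted replica of $\mathrm{SFM}(d,p)$.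 $\mathrm{SFM}(d,p)$ is recurrent if, almost surely, there are infinitely many visits to the root. *)

theory Defs
  imports "HOL-Probability.Probability"
begin

text \<open>
  A vertex of the rooted \<open>d\<close>-ary tree is a list of child indices below \<open>d\<close>, with the most
  recent index at the head: the root is \<open>[]\<close> and the parent of \<open>v \<noteq> []\<close> is \<open>tl v\<close>.
  A frog is named by the vertex at which it starts.
\<close>

type_synonym vertex = "nat list"

definition children :: "nat \<Rightarrow> vertex \<Rightarrow> vertex set" where
  "children d v = (\<lambda>i. i # v) ` {..<d}"

text \<open>
  A history is the nonempty list of the sites visited so far by one frog, latest site first; its
  last element is the starting vertex.  The law of the next site depends on the history only
  through its length and its last two sites.  (Histories that come back to the root also get a
  law here, but it is never used, since such a frog is killed.)
\<close>

type_synonym history = "vertex list"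

definition up_prob :: "nat \<Rightarrow> real \<Rightarrow> real" where
  "up_prob d p = p / (p + (1 - p) * (real d - 1) / real d)"

fun next_site :: "nat \<Rightarrow> real \<Rightarrow> history \<Rightarrow> vertex pmf" where
  "next_site d p [] = return_pmf []"
| "next_site d p [v] =
     (if v = [] then pmf_of_set (children d v)
      else bind_pmf (bernoulli_pmf p)
             (\<lambda>up. if up then return_pmf (tl v) else pmf_of_set (children d v)))"
| "next_site d p (v # u # h) =
     (if u \<in> children d v
      then bind_pmf (bernoulli_pmf (up_prob d p))
             (\<lambda>up. if up then return_pmf (tl v) else pmf_of_set (children d v - {u}))
      else pmf_of_set (children d v))"

text \<open>
  The randomness: for each history \<open>h\<close> an independent choice \<open>\<omega> h\<close> of the site to be visited
  next.  Along the path of a frog the histories grow strictly, and histories of different frogs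
  differ in their last element, so each choice is used at most once: the paths are independent
  and have the transition probabilities \<open>next_site\<close>.
\<close>

definition frog_space :: "nat \<Rightarrow> real \<Rightarrow> (history \<Rightarrow> vertex) measure" where
  "frog_space d p = PiM UNIV (\<lambda>h. measure_pmf (next_site d p h))"

text \<open>
  State of a frog.  A frog that enters the root is \<open>Active\<close> there at that time and \<open>Dead\<close> from
  the next time on.  A non-root vertex has been visited iff its own frog is not \<open>Asleep\<close>.
\<close>

datatype frog_state = Asleep | Active history | Dead

type_synonym configuration = "vertex \<Rightarrow> frog_state"

definition attempts ::
  "(history \<Rightarrow> vertex) \<Rightarrow> configuration \<Rightarrow> vertex \<Rightarrow> vertex \<Rightarrow> vertex \<Rightarrow> bool" where
  "attempts \<omega> s f u v \<longleftrightarrow>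
     (\<exists>h. s f = Active h \<and> hd h = u \<and> \<omega> h = v \<and> (u = [] \<longrightarrow> h = [[]]))"

text \<open>
  Simultaneous first jumps to \<open>v\<close> by the frogs in \<open>F\<close> are survived by the frog \<open>tie v F\<close> only.
\<close>

definition tie_rule :: "(vertex \<Rightarrow> vertex set \<Rightarrow> vertex) \<Rightarrow> bool" where
  "tie_rule tie \<longleftrightarrow> (\<forall>v F. F \<noteq> {} \<longrightarrow> tie v F \<in> F)"

definition jumps ::
  "nat \<Rightarrow> (vertex \<Rightarrow> vertex set \<Rightarrow> vertex) \<Rightarrow> (history \<Rightarrow> vertex) \<Rightarrow> configuration \<Rightarrow>
   vertex \<Rightarrow> vertex \<Rightarrow> vertex \<Rightarrow> bool" where
  "jumps d tie \<omega> s f u v \<longleftrightarrow> attempts \<omega> s f u v \<and>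
     (u \<noteq> [] \<and> v \<in> children d u \<longrightarrow> s v = Asleep \<and> f = tie v {g. attempts \<omega> s g u v})"

definition SFM_step ::
  "nat \<Rightarrow> (vertex \<Rightarrow> vertex set \<Rightarrow> vertex) \<Rightarrow> (history \<Rightarrow> vertex) \<Rightarrow> configuration \<Rightarrow>
   configuration" where
  "SFM_step d tie \<omega> s = (\<lambda>f. case s f of
       Asleep \<Rightarrow> if \<exists>g u. jumps d tie \<omega> s g u f then Active [f] else Asleep
     | Active h \<Rightarrow> if jumps d tie \<omega> s f (hd h) (\<omega> h) then Active (\<omega> h # h) else Dead
     | Dead \<Rightarrow> Dead)"

primrec SFM ::
  "nat \<Rightarrow> (vertex \<Rightarrow> vertex set \<Rightarrow> vertex) \<Rightarrow> (history \<Rightarrow> vertex) \<Rightarrow> nat \<Rightarrow> configuration" where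
  "SFM d tie \<omega> 0 = (\<lambda>f. if f = [] then Active [[]] else Asleep)"
| "SFM d tie \<omega> (Suc t) = SFM_step d tie \<omega> (SFM d tie \<omega> t)"

definition root_visits ::
  "nat \<Rightarrow> (vertex \<Rightarrow> vertex set \<Rightarrow> vertex) \<Rightarrow> (history \<Rightarrow> vertex) \<Rightarrow> (vertex \<times> nat) set" where
  "root_visits d tie \<omega> = {(f, t). t > 0 \<and> (\<exists>h. SFM d tie \<omega> t f = Active h \<and> hd h = [])}"

text \<open>
  How ties are broken is left open by the model; recurrence is required for every rule that
  looks only at the vertex and the set of competing frogs, not at their future choices.
\<close>

definition SFM_recurrent :: "nat \<Rightarrow> real \<Rightarrow> bool" where
  "SFM_recurrent d p \<longleftrightarrow>
     (\<forall>tie. tie_rule tie \<longrightarrow> (AE \<omega> in frog_space d p. infinite (root_visits d tie \<omega>)))"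

end

theory Submission
  imports Defs
begin

text \<open>
  Let \<open>f x\<close> be the expectation of \<open>x ^ V\<close>, with \<open>V\<close> the number of visits to the root.  The claim
  is that \<open>f\<close> vanishes on \<open>[0, 1)\<close>, and it follows from a recursive inequality for \<open>f\<close>.

  Consider the moment at which a vertex \<open>c\<close> is entered from its parent; then the frog of \<open>c\<close> wakes
  up as well.  The frog that entered \<open>c\<close> goes on to some child \<open>j\<close>, and \<open>V\<close> counts the frogs that
  come back from \<open>c\<close> to its parent.  Each child subtree behaves, once it is entered, like a replica
  of the whole process, and the drift \<open>(d - 1) / (2 d - 1)\<close> is exactly the one for which a frog that
  has come back from a child to \<open>c\<close> continues upwards with probability \<open>1/2\<close>.  Only two children
  are taken into account: \<open>j\<close>, and one further child \<open>k\<close> that is entered by the frog of \<open>c\<close> or by a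
  frog that has come back from \<open>j\<close>.  Frogs that pass through other children can only increase \<open>V\<close>.
  Thinning the returns by fair coins replaces \<open>x\<close> by \<open>y = (1 + x) / 2\<close>, and \<open>x / 2\<close> corresponds to
  the event that all frogs returning from \<open>j\<close> go up, so that no second child is entered.  Hence
  \[ f(x) \le (p x + (1 - p)/d) (f(x/2) (1 - f(y)) + f(y)^2) + p f(y)^2 \]
  with \<open>p = (d - 1) / (2 d - 1)\<close>; this is the lemma \<open>\<phi>_recursion\<close>.  As \<open>p \<ge> 1/3\<close>, the right-hand side
  is at most its value for \<open>p = 1/3\<close> and \<open>d = 2\<close>, which is the operator that Hoffman, Johnson and Junge
  found for the frog model with simple random walks on the binary tree.  Applied to the generating
  function \<open>exp (a (x - 1))\<close> of a Poisson variable it gives something below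
  \<open>exp ((a + \<epsilon>) (x - 1))\<close>, where \<open>\<epsilon> > 0\<close> is bounded away from \<open>0\<close> as long as \<open>a\<close> is bounded
  (\<open>exp_bound_improves\<close>).  So the parameter can be increased without limit, and \<open>f = 0\<close>
  (\<open>recursion_forces_zero\<close>).

  Three points need care.  The shift of a subtree to the root changes the tie rule, so the law of the
  replica is not obviously the same.  The tree is therefore not shifted at all: \<open>run c h\<close> is
  the process in the subtree of \<open>c\<close> entered by a frog with history \<open>h\<close>, and \<open>f\<close> is replaced by a
  supremum over all \<open>c\<close> and \<open>h\<close>, to which the same recursion applies.  The time and the frog that
  enter the second child \<open>k\<close> are random, but they are determined by choices other than those made
  in the subtree of \<open>k\<close> and by frogs just coming out of it (\<open>entrant_cong_outside_region\<close>), so these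
  latter choices can be resampled (\<open>expectation_mix\<close>) without changing who enters.  Finally, all
  quantities are cut off at a finite time, about twice as large on the left-hand side of the
  recursion as on the right.  They then depend on finitely many choices only, which makes
  measurability automatic, and the limit is taken at the level of the functions \<open>f\<close>.
\<close>

section \<open>Functions of finitely many independent choices\<close>

text \<open>
  The set of coordinates that determine the value may depend on the point itself, as for an
  exploration that looks at the next coordinate in the light of those already seen.
\<close>

definition finitely_determined :: "(('i \<Rightarrow> 'a) \<Rightarrow> 'b) \<Rightarrow> bool" where
  "finitely_determined f \<longleftrightarrow>
     (\<forall>\<omega>. \<exists>J. finite J \<and> (\<forall>\<omega>'. (\<forall>i\<in>J. \<omega>' i = \<omega> i) \<longrightarrow> f \<omega> = f \<omega>'))"

lemma finitely_determinedE:
  assumes "finitely_determined f"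
  obtains J where "finite J" "\<And>\<omega>'. (\<And>i. i \<in> J \<Longrightarrow> \<omega>' i = \<omega> i) \<Longrightarrow> f \<omega> = f \<omega>'"
proof -
  obtain J where "finite J" "\<forall>\<omega>'. (\<forall>i\<in>J. \<omega>' i = \<omega> i) \<longrightarrow> f \<omega> = f \<omega>'"
    using assms unfolding finitely_determined_def by metis
  then show ?thesis by (intro that[of J]) blast+
qed

lemma finitely_determined_const: "finitely_determined (\<lambda>\<omega>. c)"
  unfolding finitely_determined_def by auto

lemma finitely_determined_coordinate: "finitely_determined (\<lambda>\<omega>. \<omega> i)"
  unfolding finitely_determined_def by (auto intro!: exI[of _ "{i}"])

text \<open>
  This covers adaptive exploration: the coordinates that \<open>g\<close> reads may depend on the outcome of \<open>f\<close>.
\<close>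

lemma finitely_determined_bind:
  assumes "finitely_determined f" "\<And>a. finitely_determined (g a)"
  shows "finitely_determined (\<lambda>\<omega>. g (f \<omega>) \<omega>)"
  unfolding finitely_determined_def
proof
  fix \<omega> :: "'a \<Rightarrow> 'b"
  obtain J where J: "finite J" "\<And>\<omega>'. (\<And>i. i \<in> J \<Longrightarrow> \<omega>' i = \<omega> i) \<Longrightarrow> f \<omega> = f \<omega>'"
    using finitely_determinedE[OF assms(1)] by blast
  obtain J' where J': "finite J'" "\<And>\<omega>'. (\<And>i. i \<in> J' \<Longrightarrow> \<omega>' i = \<omega> i) \<Longrightarrow> g (f \<omega>) \<omega> = g (f \<omega>) \<omega>'"
    using finitely_determinedE[OF assms(2)] by blast
  show "\<exists>J. finite J \<and> (\<forall>\<omega>'. (\<forall>i\<in>J. \<omega>' i = \<omega> i) \<longrightarrow> g (f \<omega>) \<omega> = g (f \<omega>') \<omega>')"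
  proof (intro exI[of _ "J \<union> J'"] conjI allI impI)
    show "finite (J \<union> J')" using J(1) J'(1) by simp
    fix \<omega>' assume eq: "\<forall>i\<in>J \<union> J'. \<omega>' i = \<omega> i"
    have "f \<omega> = f \<omega>'" by (rule J(2)) (use eq in blast)
    moreover have "g (f \<omega>) \<omega> = g (f \<omega>) \<omega>'" by (rule J'(2)) (use eq in blast)
    ultimately show "g (f \<omega>) \<omega> = g (f \<omega>') \<omega>'" by (simp only:)
  qed
qed

lemma finitely_determined_comp:
  "finitely_determined f \<Longrightarrow> finitely_determined (\<lambda>\<omega>. g (f \<omega>))"
  by (rule finitely_determined_bind[of f "\<lambda>a \<omega>. g a"], assumption) (rule finitely_determined_const)

lemma finitely_determined_comp2:
  "finitely_determined f \<Longrightarrow> finitely_determined f' \<Longrightarrow> finitely_determined (\<lambda>\<omega>. g (f \<omega>) (f' \<omega>))"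
  by (rule finitely_determined_bind[of f "\<lambda>a \<omega>. g a (f' \<omega>)"], assumption)
    (rule finitely_determined_comp[of f'])

lemma finitely_determined_family:
  assumes "finite T" "\<And>t. t \<in> T \<Longrightarrow> finitely_determined (f t)"
  shows "finitely_determined (\<lambda>\<omega>. \<lambda>t. if t \<in> T then f t \<omega> else c)"
  unfolding finitely_determined_def
proof
  fix \<omega> :: "'b \<Rightarrow> 'c"
  have "\<forall>t\<in>T. \<exists>J. finite J \<and> (\<forall>\<omega>'. (\<forall>i\<in>J. \<omega>' i = \<omega> i) \<longrightarrow> f t \<omega> = f t \<omega>')"
    using assms(2) unfolding finitely_determined_def by blast
  then obtain J where J: "\<And>t. t \<in> T \<Longrightarrow> finite (J t)"
    "\<And>t \<omega>'. t \<in> T \<Longrightarrow> \<forall>i\<in>J t. \<omega>' i = \<omega> i \<Longrightarrow> f t \<omega> = f t \<omega>'"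
    by metis
  show "\<exists>J. finite J \<and> (\<forall>\<omega>'. (\<forall>i\<in>J. \<omega>' i = \<omega> i) \<longrightarrow>
      (\<lambda>t. if t \<in> T then f t \<omega> else c) = (\<lambda>t. if t \<in> T then f t \<omega>' else c))"
  proof (intro exI[of _ "\<Union>t\<in>T. J t"] conjI allI impI)
    fix \<omega>' assume eq: "\<forall>i\<in>(\<Union>t\<in>T. J t). \<omega>' i = \<omega> i"
    have "f t \<omega> = f t \<omega>'" if "t \<in> T" for t
      by (rule J(2)[OF that]) (use eq that in blast)
    then show "(\<lambda>t. if t \<in> T then f t \<omega> else c) = (\<lambda>t. if t \<in> T then f t \<omega>' else c)"
      by (intro ext) simp
  qed (use J(1) assms(1) in blast)
qed

lemma finitely_determined_restrict:
  assumes "finite T"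
  shows "finitely_determined (\<lambda>\<omega>. restrict \<omega> T)"
  unfolding restrict_def
  by (rule finitely_determined_family[of T "\<lambda>i \<omega>. \<omega> i" undefined, OF assms])
    (rule finitely_determined_coordinate)

text \<open>
  The choices in \<open>K\<close> are resampled from \<open>\<omega>'\<close>, the others are kept from \<open>\<omega>\<close>.
\<close>

definition mix :: "'i set \<Rightarrow> ('i \<Rightarrow> 'a) \<Rightarrow> ('i \<Rightarrow> 'a) \<Rightarrow> 'i \<Rightarrow> 'a" where
  "mix K \<omega> \<omega>' = (\<lambda>i. if i \<in> K then \<omega>' i else \<omega> i)"

lemma finitely_determined_mix:
  assumes "finitely_determined f"
  shows "finitely_determined (\<lambda>\<omega>'. f (mix K \<omega> \<omega>'))"
  unfolding finitely_determined_def
proof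
  fix \<omega>'
  obtain J where J: "finite J" "\<And>\<omega>''. (\<And>i. i \<in> J \<Longrightarrow> \<omega>'' i = mix K \<omega> \<omega>' i) \<Longrightarrow> f (mix K \<omega> \<omega>') = f \<omega>''"
    using finitely_determinedE[OF assms] by blast
  have "f (mix K \<omega> \<omega>') = f (mix K \<omega> \<omega>'')" if "\<forall>i\<in>J. \<omega>'' i = \<omega>' i" for \<omega>''
    by (rule J(2)) (use that in \<open>simp add: mix_def\<close>)
  then show "\<exists>J. finite J \<and> (\<forall>\<omega>''. (\<forall>i\<in>J. \<omega>'' i = \<omega>' i) \<longrightarrow> f (mix K \<omega> \<omega>') = f (mix K \<omega> \<omega>''))"
    using J(1) by blast
qed

locale pmf_product =
  fixes N :: "'i :: countable \<Rightarrow> 'a :: countable pmf"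
begin

definition law :: "('i \<Rightarrow> 'a) measure" where
  "law = PiM UNIV (\<lambda>i. measure_pmf (N i))"

interpretation coords: product_prob_space "\<lambda>i. measure_pmf (N i)" UNIV
  by standard

lemma prob_space_law: "prob_space law"
  unfolding law_def by (rule prob_space_PiM) (rule prob_space_measure_pmf)

sublocale law: prob_space law by (rule prob_space_law)

lemma space_law [simp]: "space law = UNIV"
  by (simp add: law_def space_PiM)

lemma prob_UNIV [simp]: "law.prob UNIV = 1"
  using law.prob_space by simp

lemma measurable_coordinate: "(\<lambda>\<omega>. \<omega> i) \<in> measurable law (count_space UNIV)"
proof -
  have "(\<lambda>\<omega>. \<omega> i) \<in> measurable law (measure_pmf (N i))"
    unfolding law_def by (rule measurable_component_singleton) simp
  then show ?thesis by (simp cong: measurable_cong_sets)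
qed

text \<open>
  Every preimage is a union of cylinders that fix finitely many coordinates, and there are only
  countably many such cylinders.  So no measurable structure on the target is needed.
\<close>

lemma measurable_finitely_determined:
  assumes "finitely_determined f"
  shows "f \<in> measurable law (count_space UNIV)"
proof (rule measurableI)
  fix B
  let ?cyl = "\<lambda>xs. {\<omega>. \<forall>(i, a)\<in>set xs. \<omega> i = a}"
  have cyl: "?cyl xs \<in> sets law" for xs
  proof (induction xs)
    case (Cons x xs)
    obtain i a where x: "x = (i, a)" by force
    have "{\<omega>. \<omega> i = a} \<in> sets law"
      using measurable_sets[OF measurable_coordinate, of "{a}" i] by (simp add: vimage_def)
    moreover have "?cyl (x # xs) = {\<omega>. \<omega> i = a} \<inter> ?cyl xs" using x by auto
    ultimately show ?case using Cons by auto
  qed (use sets.top[of law] in simp)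
  have "f -` B = (\<Union>xs\<in>{xs. ?cyl xs \<subseteq> f -` B}. ?cyl xs)"
  proof (intro equalityI subsetI)
    fix \<omega> assume "\<omega> \<in> f -` B"
    obtain J where J: "finite J" "\<And>\<omega>'. (\<And>i. i \<in> J \<Longrightarrow> \<omega>' i = \<omega> i) \<Longrightarrow> f \<omega> = f \<omega>'"
      using finitely_determinedE[OF assms] by blast
    obtain js where js: "set js = J" using J(1) finite_list by blast
    have "?cyl (map (\<lambda>i. (i, \<omega> i)) js) \<subseteq> f -` B"
    proof
      fix \<omega>' assume "\<omega>' \<in> ?cyl (map (\<lambda>i. (i, \<omega> i)) js)"
      then have "f \<omega> = f \<omega>'" using js by (intro J(2)) auto
      then show "\<omega>' \<in> f -` B" using \<open>\<omega> \<in> f -` B\<close> by simp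
    qed
    then show "\<omega> \<in> (\<Union>xs\<in>{xs. ?cyl xs \<subseteq> f -` B}. ?cyl xs)"
      by (intro UN_I[of "map (\<lambda>i. (i, \<omega> i)) js"]) auto
  qed auto
  moreover have "(\<Union>xs\<in>{xs. ?cyl xs \<subseteq> f -` B}. ?cyl xs) \<in> sets law"
    by (intro sets.countable_UN'' cyl) auto
  ultimately show "f -` B \<inter> space law \<in> sets law" by simp
qed simp

lemma measurable_finitely_determined_borel:
  fixes f :: "('i \<Rightarrow> 'a) \<Rightarrow> real"
  assumes "finitely_determined f"
  shows "f \<in> borel_measurable law"
  using measurable_compose[OF measurable_finitely_determined[OF assms], of "\<lambda>x. x" borel] by simp

lemma integrable_finitely_determined:
  fixes f :: "('i \<Rightarrow> 'a) \<Rightarrow> real"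
  assumes "finitely_determined f" "\<And>\<omega>. \<bar>f \<omega>\<bar> \<le> b"
  shows "integrable law f"
  by (rule law.integrable_const_bound[where B=b])
    (use assms measurable_finitely_determined_borel in auto)

lemma sets_finitely_determined:
  "finitely_determined P \<Longrightarrow> {\<omega>. P \<omega>} \<in> sets law"
  using measurable_sets[OF measurable_finitely_determined, of P "{True}"] by (simp add: vimage_def)

text \<open>
  Resampling a set of coordinates preserves the law, because on a cylinder the coordinates inside
  and outside \<open>K\<close> contribute separate factors.
\<close>

lemma distr_mix: "distr (law \<Otimes>\<^sub>M law) law (\<lambda>(\<omega>, \<omega>'). mix K \<omega> \<omega>') = law"
  and measurable_mix: "(\<lambda>(\<omega>, \<omega>'). mix K \<omega> \<omega>') \<in> measurable (law \<Otimes>\<^sub>M law) law"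
proof -
  interpret MM: pair_prob_space law law by standard
  have c: "(\<lambda>\<omega>. \<omega> i) \<in> measurable law (measure_pmf (N i))" for i
    unfolding law_def by (rule measurable_component_singleton) simp
  show meas: "(\<lambda>(\<omega>, \<omega>'). mix K \<omega> \<omega>') \<in> measurable (law \<Otimes>\<^sub>M law) law"
    unfolding law_def
  proof (rule measurable_PiM_single')
    fix i :: 'i
    show "(\<lambda>x. (case x of (\<omega>, \<omega>') \<Rightarrow> mix K \<omega> \<omega>') i) \<in>
        measurable (Pi\<^sub>M UNIV (\<lambda>i. measure_pmf (N i)) \<Otimes>\<^sub>M Pi\<^sub>M UNIV (\<lambda>i. measure_pmf (N i))) (measure_pmf (N i))"
      using measurable_compose[OF measurable_fst c[of i, unfolded law_def]]
        measurable_compose[OF measurable_snd c[of i, unfolded law_def]]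
      by (cases "i \<in> K") (simp_all add: mix_def split_def)
  qed auto
  have "distr (law \<Otimes>\<^sub>M law) (PiM UNIV (\<lambda>i. measure_pmf (N i))) (\<lambda>(\<omega>, \<omega>'). mix K \<omega> \<omega>') =
      PiM UNIV (\<lambda>i. measure_pmf (N i))"
  proof (rule measure_eqI_PiM_infinite)
    fix A :: "'i \<Rightarrow> 'a set" and J :: "'i set"
    assume J: "finite J" "J \<subseteq> UNIV"
    let ?E = "prod_emb UNIV (\<lambda>i. measure_pmf (N i)) J (Pi\<^sub>E J A)"
    let ?S = "\<lambda>J. {\<omega> \<in> space (PiM UNIV (\<lambda>i. measure_pmf (N i))). \<forall>i\<in>J. \<omega> i \<in> A i}"
    have E: "?E = ?S J"
      by (auto simp: prod_emb_def space_PiM)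
    have S: "emeasure law (?S J') = (\<Prod>i\<in>J'. emeasure (measure_pmf (N i)) (A i))" if "finite J'" for J'
      unfolding law_def using that by (subst coords.emeasure_PiM_Collect) auto
    have Sm: "?S J' \<in> sets law" if "finite J'" for J'
    proof -
      have "?S J' = prod_emb UNIV (\<lambda>i. measure_pmf (N i)) J' (Pi\<^sub>E J' A)"
        by (auto simp: prod_emb_def space_PiM)
      then show ?thesis unfolding law_def using that by (auto intro!: sets_PiM_I)
    qed
    have "emeasure (distr (law \<Otimes>\<^sub>M law) (PiM UNIV (\<lambda>i. measure_pmf (N i))) (\<lambda>(\<omega>, \<omega>'). mix K \<omega> \<omega>')) ?E
        = emeasure (law \<Otimes>\<^sub>M law) ((\<lambda>(\<omega>, \<omega>'). mix K \<omega> \<omega>') -` ?E \<inter> space (law \<Otimes>\<^sub>M law))"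
      using meas Sm[OF J(1)] by (intro emeasure_distr) (auto simp: law_def E)
    also have "(\<lambda>(\<omega>, \<omega>'). mix K \<omega> \<omega>') -` ?E \<inter> space (law \<Otimes>\<^sub>M law) = ?S (J - K) \<times> ?S (J \<inter> K)"
      unfolding E by (auto simp: space_PiM space_pair_measure mix_def)
    also have "emeasure (law \<Otimes>\<^sub>M law) \<dots> = emeasure law (?S (J - K)) * emeasure law (?S (J \<inter> K))"
      using J by (intro law.emeasure_pair_measure_Times Sm) auto
    also have "\<dots> = (\<Prod>i\<in>(J - K) \<union> (J \<inter> K). emeasure (measure_pmf (N i)) (A i))"
      using J by (subst prod.union_disjoint) (auto simp: S)
    also have "(J - K) \<union> (J \<inter> K) = J" by auto
    also have "(\<Prod>i\<in>J. emeasure (measure_pmf (N i)) (A i)) = emeasure law ?E"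
      unfolding E by (simp add: S J)
    finally show "emeasure (distr (law \<Otimes>\<^sub>M law) (PiM UNIV (\<lambda>i. measure_pmf (N i))) (\<lambda>(\<omega>, \<omega>'). mix K \<omega> \<omega>')) ?E
        = emeasure (PiM UNIV (\<lambda>i. measure_pmf (N i))) ?E" by (simp add: law_def)
  next
    show "finite_measure (distr (law \<Otimes>\<^sub>M law) (PiM UNIV (\<lambda>i. measure_pmf (N i))) (\<lambda>(\<omega>, \<omega>'). mix K \<omega> \<omega>'))"
      using meas by (intro prob_space.finite_measure MM.prob_space_distr) (simp add: law_def)
  qed auto
  then show "distr (law \<Otimes>\<^sub>M law) law (\<lambda>(\<omega>, \<omega>'). mix K \<omega> \<omega>') = law" by (simp add: law_def)
qed

text \<open>
  This is how independence is used throughout: condition on the coordinates outside \<open>K\<close>, and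
  integrate over fresh ones inside \<open>K\<close>.
\<close>

lemma expectation_mix:
  fixes f :: "('i \<Rightarrow> 'a) \<Rightarrow> real"
  assumes "finitely_determined f" "\<And>\<omega>. \<bar>f \<omega>\<bar> \<le> b"
  shows "(\<integral>\<omega>. f \<omega> \<partial>law) = (\<integral>\<omega>. (\<integral>\<omega>'. f (mix K \<omega> \<omega>') \<partial>law) \<partial>law)"
    and "integrable law (\<lambda>\<omega>. \<integral>\<omega>'. f (mix K \<omega> \<omega>') \<partial>law)"
proof -
  interpret MM: pair_prob_space law law by standard
  have f: "f \<in> borel_measurable law" by (rule measurable_finitely_determined_borel[OF assms(1)])
  have int: "integrable (law \<Otimes>\<^sub>M law) (\<lambda>(\<omega>, \<omega>'). f (mix K \<omega> \<omega>'))"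
    using measurable_compose[OF measurable_mix f, of K] assms(2)
    by (intro MM.integrable_const_bound[where B=b]) (auto simp: split_def)
  have "(\<integral>\<omega>. f \<omega> \<partial>law) = (\<integral>\<omega>. f \<omega> \<partial>distr (law \<Otimes>\<^sub>M law) law (\<lambda>(\<omega>, \<omega>'). mix K \<omega> \<omega>'))"
    by (simp add: distr_mix)
  also have "\<dots> = (\<integral>z. (case z of (\<omega>, \<omega>') \<Rightarrow> f (mix K \<omega> \<omega>')) \<partial>(law \<Otimes>\<^sub>M law))"
    using f measurable_mix by (subst integral_distr) (auto simp: split_def)
  also have "\<dots> = (\<integral>\<omega>. (\<integral>\<omega>'. f (mix K \<omega> \<omega>') \<partial>law) \<partial>law)"
    using MM.integral_fst'[OF int] by simp
  finally show "(\<integral>\<omega>. f \<omega> \<partial>law) = (\<integral>\<omega>. (\<integral>\<omega>'. f (mix K \<omega> \<omega>') \<partial>law) \<partial>law)" .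
  show "integrable law (\<lambda>\<omega>. \<integral>\<omega>'. f (mix K \<omega> \<omega>') \<partial>law)"
    using MM.integrable_fst'[OF int] by simp
qed

lemma expectation_coordinate:
  fixes g :: "'a \<Rightarrow> real"
  shows "(\<integral>\<omega>. g (\<omega> i) \<partial>law) = measure_pmf.expectation (N i) g"
proof -
  have "measure_pmf.expectation (N i) g = (\<integral>x. g x \<partial>distr law (measure_pmf (N i)) (\<lambda>\<omega>. \<omega> i))"
    unfolding law_def by (subst coords.PiM_component) simp_all
  also have "\<dots> = (\<integral>\<omega>. g (\<omega> i) \<partial>law)"
    unfolding law_def by (intro integral_distr measurable_component_singleton) auto
  finally show ?thesis ..
qed

lemma expectation_prod_coordinates:
  fixes g :: "'a \<Rightarrow> real"
  assumes "finite R" "\<And>i. i \<in> R \<Longrightarrow> measure_pmf.expectation (N i) g = \<theta>" "\<And>a. 0 \<le> g a" "\<And>a. g a \<le> 1"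
  shows "(\<integral>\<omega>. (\<Prod>i\<in>R. g (\<omega> i)) \<partial>law) = \<theta> ^ card R"
  using assms(1,2)
proof (induction R)
  case empty
  then show ?case by simp
next
  case (insert j R)
  have b: "\<bar>\<Prod>i\<in>S. g (\<omega> i)\<bar> \<le> 1" for S and \<omega> :: "'i \<Rightarrow> 'a"
    using assms(3,4) by (simp add: prod_nonneg prod_le_1)
  have fd: "finitely_determined (\<lambda>\<omega>. \<Prod>i\<in>S. g (\<omega> i))" if "finite S" for S
    unfolding finitely_determined_def using that by (auto intro!: exI[of _ S] prod.cong)
  have "(\<integral>\<omega>. (\<Prod>i\<in>insert j R. g (\<omega> i)) \<partial>law) =
      (\<integral>\<omega>. (\<integral>\<omega>'. (\<Prod>i\<in>insert j R. g (mix {j} \<omega> \<omega>' i)) \<partial>law) \<partial>law)"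
    by (rule expectation_mix(1)[OF fd b]) (use insert in simp)
  also have "\<dots> = (\<integral>\<omega>. (\<integral>\<omega>'. g (\<omega>' j) * (\<Prod>i\<in>R. g (\<omega> i)) \<partial>law) \<partial>law)"
    using insert by (intro Bochner_Integration.integral_cong refl)
      (auto simp: mix_def intro!: prod.cong arg_cong2[where f="(*)"])
  also have "\<dots> = (\<integral>\<omega>. \<theta> * (\<Prod>i\<in>R. g (\<omega> i)) \<partial>law)"
    using insert by (simp add: expectation_coordinate)
  also have "\<dots> = \<theta> ^ card (insert j R)" using insert by simp
  finally show ?case .
qed

lemma AE_coordinates_in_support: "AE \<omega> in law. \<forall>i. \<omega> i \<in> set_pmf (N i)"
proof -
  have "AE \<omega> in law. \<omega> i \<in> set_pmf (N i)" for i
    unfolding law_def by (rule coords.AE_component) (auto simp: AE_measure_pmf)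
  then show ?thesis by (simp add: AE_all_countable)
qed

end

section \<open>The process in a single subtree\<close>

definition subtree :: "vertex \<Rightarrow> vertex set" where
  "subtree c = {v. \<exists>w. v = w @ c}"

lemma subtree_refl [simp, intro]: "c \<in> subtree c"
  by (simp add: subtree_def)

lemma subtree_trans: "v \<in> subtree c \<Longrightarrow> w \<in> subtree v \<Longrightarrow> w \<in> subtree c"
  by (auto simp: subtree_def)

lemma subtree_Cons: "v \<in> subtree c \<Longrightarrow> i # v \<in> subtree c"
  by (force simp: subtree_def intro: exI[of _ "i # _"])

lemma subtree_length: "v \<in> subtree c \<Longrightarrow> length c \<le> length v"
  by (auto simp: subtree_def)

lemma subtree_tl: "tl v \<in> subtree c \<Longrightarrow> v \<in> subtree c"
  using subtree_Cons[of "tl v" c "hd v"] by (cases v) auto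

lemma subtree_enter: "i # v \<in> subtree c \<Longrightarrow> v \<notin> subtree c \<Longrightarrow> i # v = c"
  unfolding subtree_def by (auto simp: Cons_eq_append_conv)

lemma parent_notin_subtree: "c \<noteq> [] \<Longrightarrow> tl c \<notin> subtree c"
  using subtree_length[of "tl c" c] by (cases c) auto

lemma child_notin_subtree: "c \<notin> subtree (k # c)"
  using subtree_length[of c "k # c"] by auto

lemma subtree_antisym: "v \<in> subtree c \<Longrightarrow> c \<in> subtree v \<Longrightarrow> v = c"
  unfolding subtree_def by auto

lemma subtree_siblings: "v \<in> subtree (j # c) \<Longrightarrow> v \<in> subtree (k # c) \<Longrightarrow> j = k"
  unfolding subtree_def by (auto simp: append_eq_append_conv2 append_eq_Cons_conv Cons_eq_append_conv)

lemma children_iff: "v \<in> children d u \<longleftrightarrow> (\<exists>i<d. v = i # u)"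
  by (auto simp: children_def)

lemma parent_notin_children: "tl c \<notin> children d c"
proof
  assume "tl c \<in> children d c"
  then obtain i where "tl c = i # c" by (auto simp: children_def)
  then have "length (tl c) = Suc (length c)" by simp
  then show False by simp
qed

definition to_neighbours :: "nat \<Rightarrow> (history \<Rightarrow> vertex) \<Rightarrow> bool" where
  "to_neighbours d \<omega> \<longleftrightarrow> (\<forall>h. h \<noteq> [] \<longrightarrow> \<omega> h = tl (hd h) \<or> \<omega> h \<in> children d (hd h))"

text \<open>
  In the process restricted to the subtree of \<open>c\<close>, the parent of \<open>c\<close> plays the role of the root:
  frogs are stopped there, and their later moves are not part of this process.
\<close>

definition kill :: "vertex \<Rightarrow> configuration \<Rightarrow> configuration" where
  "kill c s = (\<lambda>f. case s f of Active h \<Rightarrow> if hd h \<in> subtree c then s f else Dead | _ \<Rightarrow> s f)"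

lemma kill_Asleep [simp]: "kill c s f = Asleep \<longleftrightarrow> s f = Asleep"
  by (simp add: kill_def split: frog_state.splits)

lemma kill_Active [simp]: "kill c s f = Active h \<longleftrightarrow> s f = Active h \<and> hd h \<in> subtree c"
  by (auto simp: kill_def split: frog_state.splits)

definition confined :: "vertex \<Rightarrow> configuration \<Rightarrow> bool" where
  "confined c s \<longleftrightarrow> (\<forall>f h. s f = Active h \<longrightarrow> hd h \<in> subtree c)"

lemma confinedD: "confined c s \<Longrightarrow> s f = Active h \<Longrightarrow> hd h \<in> subtree c"
  unfolding confined_def by blast

lemma confined_kill: "confined c (kill c s)"
  unfolding confined_def by simp

text \<open>
  The situation at the moment when \<open>c\<close> is entered by the frog whose history before this jump was \<open>h\<close>.
  The other frogs outside the subtree are declared \<open>Dead\<close>, so that they cannot be woken up.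
\<close>

definition start :: "vertex \<Rightarrow> history \<Rightarrow> configuration" where
  "start c h = (\<lambda>f. if f = last h then Active (c # h) else if f = c then Active [c]
                    else if f \<in> subtree c then Asleep else Dead)"

definition entry_history :: "vertex \<Rightarrow> history \<Rightarrow> bool" where
  "entry_history c h \<longleftrightarrow> c \<noteq> [] \<and> h \<noteq> [] \<and> hd h = tl c \<and> set h \<inter> subtree c = {}"

lemma entry_historyD:
  assumes "entry_history c h"
  shows "c \<noteq> []" "h \<noteq> []" "last h \<notin> subtree c" "hd h = tl c" "set h \<inter> subtree c = {}"
  using assms last_in_set[of h] unfolding entry_history_def by blast+

text \<open>
  Together these conditions say that a subtree whose top vertex sleeps is untouched: no frog has
  woken up in it, and no active frog has passed through it.
\<close>

definition entry_inv :: "vertex \<Rightarrow> configuration \<Rightarrow> bool" where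
  "entry_inv c s \<longleftrightarrow>
     (\<forall>f h. s f = Active h \<longrightarrow> h \<noteq> [] \<and> last h = f \<and> (\<forall>w\<in>set h \<inter> subtree c. s w \<noteq> Asleep)) \<and>
     (\<forall>v w. s v = Asleep \<longrightarrow> w \<in> subtree v \<longrightarrow> s w = Asleep) \<and>
     (\<forall>v. s v = Asleep \<longrightarrow> v \<in> subtree c)"

text \<open>
  The configuration \<open>s\<close> of a larger process, seen inside the subtree of \<open>c\<close>, coincides with the
  configuration \<open>s'\<close> of the process in that subtree alone.  The last conditions ensure that nothing
  enters the subtree from outside any more: \<open>c\<close> has been visited, and no frog is about to make the
  exempted first jump from the root.
\<close>

definition agree_on :: "vertex \<Rightarrow> configuration \<Rightarrow> configuration \<Rightarrow> bool" where
  "agree_on c s s' \<longleftrightarrow>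
     (\<forall>f h. hd h \<in> subtree c \<longrightarrow> s f = Active h \<longleftrightarrow> s' f = Active h) \<and>
     (\<forall>v. s' v = Asleep \<longleftrightarrow> v \<in> subtree c \<and> s v = Asleep) \<and>
     s c \<noteq> Asleep \<and> s [] \<noteq> Asleep \<and> (\<forall>f. s f \<noteq> Active [] \<and> s f \<noteq> Active [[]])"

lemma finite_Active_histories:
  assumes "finite {f. \<exists>h. s f = Active h}"
  shows "finite {h. \<exists>f. s f = Active h}"
proof -
  have "{h. \<exists>f. s f = Active h} \<subseteq> (\<lambda>f. THE h. s f = Active h) ` {f. \<exists>h. s f = Active h}"
  proof
    fix h assume "h \<in> {h. \<exists>f. s f = Active h}"
    then obtain f where "s f = Active h" by blast
    then show "h \<in> (\<lambda>f. THE h. s f = Active h) ` {f. \<exists>h. s f = Active h}"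
      by (intro image_eqI[of _ _ f]) auto
  qed
  then show ?thesis using assms finite_surj by blast
qed

lemma attempts_cong:
  assumes "\<And>f h. s f = Active h \<Longrightarrow> \<omega> h = \<omega>' h"
  shows "attempts \<omega> s = attempts \<omega>' s"
  unfolding attempts_def fun_eq_iff using assms by metis

locale frog_tie =
  fixes d :: nat and tie :: "vertex \<Rightarrow> vertex set \<Rightarrow> vertex"
  assumes d2: "2 \<le> d" and tie: "tie_rule tie"
begin

abbreviation "jumping \<equiv> jumps d tie"
abbreviation "step \<equiv> SFM_step d tie"

lemma jumping_Active:
  assumes "jumping \<omega> s f u v"
  obtains h where "s f = Active h" "hd h = u" "\<omega> h = v" "u = [] \<longrightarrow> h = [[]]"
  using assms unfolding jumps_def attempts_def by blast

lemma step_Asleep: "step \<omega> s f = Asleep \<longleftrightarrow> s f = Asleep \<and> \<not> (\<exists>g u. jumping \<omega> s g u f)"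
  by (auto simp: SFM_step_def split: frog_state.splits)

lemma step_Active: "step \<omega> s f = Active h' \<longleftrightarrow>
    (s f = Asleep \<and> (\<exists>g u. jumping \<omega> s g u f) \<and> h' = [f]) \<or>
    (\<exists>h. s f = Active h \<and> jumping \<omega> s f (hd h) (\<omega> h) \<and> h' = \<omega> h # h)"
  by (auto simp: SFM_step_def split: frog_state.splits)

lemma step_cong:
  assumes "\<And>f h. s f = Active h \<Longrightarrow> \<omega> h = \<omega>' h"
  shows "step \<omega> s = step \<omega>' s"
proof -
  have j: "jumping \<omega> s = jumping \<omega>' s"
    unfolding jumps_def using attempts_cong[of s \<omega> \<omega>', OF assms] by simp
  show ?thesis
    unfolding SFM_step_def j by (rule ext) (auto split: frog_state.splits simp: assms)
qed

lemma finite_Active_step: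
  assumes "finite {f. \<exists>h. s f = Active h}"
  shows "finite {f. \<exists>h. step \<omega> s f = Active h}"
proof -
  have "{f. \<exists>h. step \<omega> s f = Active h} \<subseteq>
      {f. \<exists>h. s f = Active h} \<union> \<omega> ` {h. \<exists>f. s f = Active h}"
    by (auto simp: step_Active elim!: jumping_Active)
  then show ?thesis
    using assms finite_Active_histories[OF assms] by (auto intro: finite_subset)
qed

text \<open>
  The process in the subtree of \<open>c\<close>, entered at time \<open>0\<close> by a frog with history \<open>h\<close>.
\<close>

primrec run :: "vertex \<Rightarrow> history \<Rightarrow> (history \<Rightarrow> vertex) \<Rightarrow> nat \<Rightarrow> configuration" where
  "run c h \<omega> 0 = start c h"
| "run c h \<omega> (Suc t) = step \<omega> (kill c (run c h \<omega> t))"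

text \<open>
  A frog that comes back from \<open>c\<close> to its parent is recorded by its history at that moment.  The
  first two sites of this history are all that the law of its next move depends on.
\<close>

definition returns :: "vertex \<Rightarrow> history \<Rightarrow> (history \<Rightarrow> vertex) \<Rightarrow> nat \<Rightarrow> history set" where
  "returns c h \<omega> t = {h'. \<exists>s\<le>t. \<exists>f r. run c h \<omega> s f = Active h' \<and> h' = tl c # c # r}"

lemma returnsI: "run c h \<omega> s f = Active (tl c # c # r) \<Longrightarrow> s \<le> t \<Longrightarrow> tl c # c # r \<in> returns c h \<omega> t"
  unfolding returns_def by blast

lemma returns_mono: "t \<le> t' \<Longrightarrow> returns c h \<omega> t \<subseteq> returns c h \<omega> t'"
  unfolding returns_def using order_trans by blast

lemma finite_Active_kill:
  "finite {f. \<exists>h. s f = Active h} \<Longrightarrow> finite {f. \<exists>h. kill c s f = Active h}"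
  by (rule finite_subset[rotated]) auto

lemma finite_Active_run: "finite {f. \<exists>h'. run c h \<omega> t f = Active h'}"
proof (induction t)
  case 0
  have "{f. \<exists>h'. run c h \<omega> 0 f = Active h'} \<subseteq> {last h, c}"
    by (auto simp: start_def split: if_splits)
  then show ?case by (auto intro: finite_subset)
next
  case (Suc t)
  then show ?case
    using finite_Active_step[OF finite_Active_kill] by simp
qed

lemma finite_returns: "finite (returns c h \<omega> t)"
proof -
  have "returns c h \<omega> t \<subseteq> (\<Union>s\<le>t. {h'. \<exists>f. run c h \<omega> s f = Active h'})"
    unfolding returns_def by auto
  then show ?thesis
    by (rule finite_subset) (simp add: finite_Active_histories finite_Active_run)
qed

text \<open>
  At each time only finitely many frogs are active, and the next step reads their choices only.
\<close>

lemma finitely_determined_run: "finitely_determined (\<lambda>\<omega>. run c h \<omega> t)"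
proof (induction t)
  case 0
  then show ?case by (simp add: finitely_determined_const)
next
  case (Suc t)
  define g where "g s \<omega> = (if finite {f. \<exists>h. s f = Active h} then step \<omega> (kill c s) else s)" for s \<omega>
  have "finitely_determined (g s)" for s
  proof (cases "finite {f. \<exists>h. s f = Active h}")
    case True
    have "finitely_determined (\<lambda>\<omega>. step \<omega> (kill c s))"
      unfolding finitely_determined_def
    proof
      fix \<omega>
      show "\<exists>J. finite J \<and> (\<forall>\<omega>'. (\<forall>i\<in>J. \<omega>' i = \<omega> i) \<longrightarrow> step \<omega> (kill c s) = step \<omega>' (kill c s))"
        using finite_Active_histories[OF True]
        by (intro exI[of _ "{h. \<exists>f. s f = Active h}"]) (force intro!: step_cong)
    qed
    then show ?thesis using True by (simp add: g_def[abs_def])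
  next
    case False
    then show ?thesis by (simp add: g_def[abs_def] finitely_determined_const)
  qed
  then have "finitely_determined (\<lambda>\<omega>. g (run c h \<omega> t) \<omega>)"
    by (rule finitely_determined_bind[OF Suc])
  moreover have "g (run c h \<omega> t) \<omega> = run c h \<omega> (Suc t)" for \<omega>
    using finite_Active_run[of c h \<omega> t] by (simp add: g_def)
  ultimately show ?case by simp
qed

lemma run_not_Active_Nil: "run c h \<omega> t f \<noteq> Active []"
  by (cases t) (auto simp: start_def step_Active)

text \<open>
  The subtree process is autonomous: only choices made at sites inside the subtree matter.
\<close>

lemma run_cong:
  assumes "\<And>h'. h' \<noteq> [] \<Longrightarrow> hd h' \<in> subtree c \<Longrightarrow> \<omega> h' = \<omega>' h'"
  shows "run c h \<omega> t = run c h \<omega>' t"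
proof (induction t)
  case (Suc t)
  have "step \<omega> (kill c (run c h \<omega> t)) = step \<omega>' (kill c (run c h \<omega> t))"
  proof (rule step_cong)
    fix f h' assume "kill c (run c h \<omega> t) f = Active h'"
    then show "\<omega> h' = \<omega>' h'" using run_not_Active_Nil[of c h \<omega> t f] by (intro assms) auto
  qed
  then show ?case using Suc by simp
qed simp

lemma returns_cong:
  assumes "\<And>h'. h' \<noteq> [] \<Longrightarrow> hd h' \<in> subtree c \<Longrightarrow> \<omega> h' = \<omega>' h'"
  shows "returns c h \<omega> t = returns c h \<omega>' t"
  unfolding returns_def using run_cong[of c \<omega> \<omega>', OF assms] by simp

lemma run_awake_mono: "run c h \<omega> s v \<noteq> Asleep \<Longrightarrow> s \<le> t \<Longrightarrow> run c h \<omega> t v \<noteq> Asleep"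
  by (rotate_tac, induction t rule: dec_induct) (simp_all add: step_Asleep)

lemma entry_inv_start:
  assumes "entry_history c h"
  shows "entry_inv c (start c h)"
proof -
  have h: "c \<noteq> []" "h \<noteq> []" "set h \<inter> subtree c = {}" "last h \<notin> subtree c"
    using assms last_in_set[of h] unfolding entry_history_def by blast+
  show ?thesis
    unfolding entry_inv_def
  proof (intro conjI allI impI)
    fix f h' assume a: "start c h f = Active h'"
    then show "h' \<noteq> []" "last h' = f" using h by (auto simp: start_def split: if_splits)
    show "\<forall>w\<in>set h' \<inter> subtree c. start c h w \<noteq> Asleep"
      using a h by (auto simp: start_def split: if_splits)
  next
    fix v w assume v: "start c h v = Asleep" and w: "w \<in> subtree v"
    have "v \<in> subtree c" "v \<noteq> c" using v by (auto simp: start_def split: if_splits)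
    then have "w \<in> subtree c" "w \<noteq> c" using w subtree_trans subtree_antisym by blast+
    then show "start c h w = Asleep" using h by (auto simp: start_def)
  next
    fix v assume "start c h v = Asleep"
    then show "v \<in> subtree c" by (auto simp: start_def split: if_splits)
  qed
qed

lemma entry_inv_kill: "entry_inv c s \<Longrightarrow> entry_inv c (kill c s)"
  unfolding entry_inv_def kill_Asleep kill_Active by blast

lemma entry_invD:
  assumes "entry_inv c s"
  shows "s f = Active h \<Longrightarrow> h \<noteq> []" "s f = Active h \<Longrightarrow> last h = f"
    "s f = Active h \<Longrightarrow> w \<in> set h \<Longrightarrow> w \<in> subtree c \<Longrightarrow> s w \<noteq> Asleep"
    "s v = Asleep \<Longrightarrow> w \<in> subtree v \<Longrightarrow> s w = Asleep" "s v = Asleep \<Longrightarrow> v \<in> subtree c"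
  using assms unfolding entry_inv_def by blast+

text \<open>
  A jump into a sleeping subtree leads from the parent of its top vertex to the top vertex: the
  jumping frog stands on an awake vertex, hence outside, and it moves to a neighbour.
\<close>

lemma woken_from_parent:
  assumes "entry_inv c s" "confined c s" "to_neighbours d \<omega>"
    and "s v = Asleep" "s f = Active h" "\<omega> h \<in> subtree v"
  shows "\<omega> h = v" "hd h = tl v" "v \<noteq> []"
proof -
  have h: "h \<noteq> []" "s (hd h) \<noteq> Asleep"
    using entry_invD(1)[OF assms(1,5)] entry_invD(3)[OF assms(1,5), of "hd h"] confinedD[OF assms(2,5)] by auto
  then have nin: "hd h \<notin> subtree v" using entry_invD(4)[OF assms(1,4)] by blast
  have "\<omega> h \<noteq> tl (hd h)" using nin subtree_tl assms(6) by metis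
  then obtain i where i: "\<omega> h = i # hd h" using assms(3) h unfolding to_neighbours_def children_iff by blast
  then show "\<omega> h = v" using subtree_enter nin assms(6) by simp
  then show "hd h = tl v" "v \<noteq> []" using i by auto
qed

lemma entry_inv_step:
  assumes inv: "entry_inv c s" and sub: "confined c s"
    and nb: "to_neighbours d \<omega>"
  shows "entry_inv c (step \<omega> s)"
  unfolding entry_inv_def
proof (intro conjI allI impI)
  fix f h' assume a: "step \<omega> s f = Active h'"
  show "h' \<noteq> []" "last h' = f"
    using a entry_invD(1,2)[OF inv] by (auto simp: step_Active)
  show "\<forall>w\<in>set h' \<inter> subtree c. step \<omega> s w \<noteq> Asleep"
    using a entry_invD(3)[OF inv] unfolding step_Active step_Asleep by fastforce
next
  fix v w assume v: "step \<omega> s v = Asleep" and w: "w \<in> subtree v"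
  have sv: "s v = Asleep" "\<And>g u. \<not> jumping \<omega> s g u v" using v by (auto simp: step_Asleep)
  have "\<not> jumping \<omega> s g u w" for g u
  proof
    assume j: "jumping \<omega> s g u w"
    then obtain h where "s g = Active h" "\<omega> h = w" by (elim jumping_Active)
    then have "w = v" using woken_from_parent(1)[OF inv sub nb sv(1)] w by blast
    then show False using j sv(2) by blast
  qed
  then show "step \<omega> s w = Asleep" using entry_invD(4)[OF inv sv(1) w] by (simp add: step_Asleep)
next
  fix v assume "step \<omega> s v = Asleep"
  then show "v \<in> subtree c" using entry_invD(5)[OF inv] by (simp add: step_Asleep)
qed

lemma entry_inv_run:
  assumes "entry_history c h" "to_neighbours d \<omega>"
  shows "entry_inv c (run c h \<omega> t)"
proof (induction t)
  case 0
  then show ?case using assms entry_inv_start by simp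
next
  case (Suc t)
  then show ?case using entry_inv_step[OF entry_inv_kill[OF Suc] confined_kill assms(2)] by simp
qed

lemma agree_on_kill:
  assumes "agree_on c' s s'" "c' \<in> subtree c"
  shows "agree_on c' (kill c s) s'"
  unfolding agree_on_def
proof (intro conjI allI impI)
  fix f h assume "hd h \<in> subtree c'"
  then show "kill c s f = Active h \<longleftrightarrow> s' f = Active h"
    using assms(1) subtree_trans[OF assms(2)] unfolding agree_on_def by simp
qed (use assms(1) in \<open>simp_all add: agree_on_def\<close>)

text \<open>
  Restriction to a subtree commutes with a step, because an entered subtree is never entered
  again.  The second statement adds that frogs just leaving the subtree are seen in the larger
  process too; this is where returns are passed on.
\<close>

lemma agree_on_step:
  assumes ag: "agree_on c s s'" and nb: "to_neighbours d \<omega>" and c: "c \<noteq> []"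
  shows "agree_on c (step \<omega> s) (step \<omega> (kill c s'))"
    and "step \<omega> (kill c s') f = Active h \<Longrightarrow> step \<omega> s f = Active h"
proof -
  let ?k = "kill c s'"
  have act: "s f = Active h \<longleftrightarrow> s' f = Active h" if "hd h \<in> subtree c" for f h
    using ag that unfolding agree_on_def by blast
  have asl: "s' v = Asleep \<longleftrightarrow> v \<in> subtree c \<and> s v = Asleep" for v
    using ag unfolding agree_on_def by blast
  have oth: "s c \<noteq> Asleep" "s [] \<noteq> Asleep" "\<And>f. s f \<noteq> Active []" "\<And>f. s f \<noteq> Active [[]]"
    using ag unfolding agree_on_def by blast+
  have nin: "[] \<notin> subtree c" using c subtree_length[of "[]" c] by auto
  have at: "attempts \<omega> ?k f u v \<longleftrightarrow> attempts \<omega> s f u v" if "u \<in> subtree c" for f u v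
    using act that unfolding attempts_def by auto
  have ju: "jumping \<omega> ?k f u v \<longleftrightarrow> jumping \<omega> s f u v" if "u \<in> subtree c" for f u v
  proof -
    have "v \<in> subtree c" if "v \<in> children d u"
      using that \<open>u \<in> subtree c\<close> subtree_Cons by (auto simp: children_def)
    then show ?thesis unfolding jumps_def at[OF that] using asl by auto
  qed
  have kact: "?k f = Active h \<longleftrightarrow> s f = Active h \<and> hd h \<in> subtree c" for f h
    using act by auto
  have ksrc: "u \<in> subtree c" if "jumping \<omega> ?k f u v" for f u v
    using that by (elim jumping_Active) auto
  \<comment> \<open>A jump from outside could only go to \<open>c\<close> itself, but \<open>c\<close> is awake and such a jump is lethal.\<close>
  have src: "u \<in> subtree c" if j: "jumping \<omega> s f u v" and v: "v \<in> subtree c" for f u v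
  proof (rule ccontr)
    assume u: "u \<notin> subtree c"
    obtain h where h: "s f = Active h" "hd h = u" "\<omega> h = v" "u = [] \<longrightarrow> h = [[]]"
      using j by (elim jumping_Active)
    have "h \<noteq> []" "u \<noteq> []" using h oth(3,4) by auto
    moreover have "v \<noteq> tl u" using u v subtree_tl by blast
    ultimately have "v \<in> children d u" using h nb unfolding to_neighbours_def by blast
    then obtain i where "v = i # u" by (auto simp: children_iff)
    then have "v = c" using subtree_enter u v by blast
    then show False using j oth(1) \<open>v \<in> children d u\<close> \<open>u \<noteq> []\<close> unfolding jumps_def by blast
  qed
  have woken: "(\<exists>g u. jumping \<omega> ?k g u v) \<longleftrightarrow> (\<exists>g u. jumping \<omega> s g u v)" if "v \<in> subtree c" for v
    using ju ksrc src that by blast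
  have 1: "step \<omega> s f = Active h" if a: "step \<omega> ?k f = Active h" for f h
    using a unfolding step_Active kact kill_Asleep asl using woken ju by blast
  have 2: "step \<omega> ?k f = Active h" if a: "step \<omega> s f = Active h" and h: "hd h \<in> subtree c" for f h
    using a unfolding step_Active
  proof (elim disjE conjE exE)
    fix g u assume "s f = Asleep" "h = [f]" "jumping \<omega> s g u f"
    then show "?k f = Asleep \<and> (\<exists>g u. jumping \<omega> ?k g u f) \<and> h = [f] \<or>
      (\<exists>h'. ?k f = Active h' \<and> jumping \<omega> ?k f (hd h') (\<omega> h') \<and> h = \<omega> h' # h')"
      using h woken[of f] asl by auto
  next
    fix h' assume "s f = Active h'" "h = \<omega> h' # h'" "jumping \<omega> s f (hd h') (\<omega> h')"
    then show "?k f = Asleep \<and> (\<exists>g u. jumping \<omega> ?k g u f) \<and> h = [f] \<or>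
      (\<exists>h'. ?k f = Active h' \<and> jumping \<omega> ?k f (hd h') (\<omega> h') \<and> h = \<omega> h' # h')"
      using h src[of f "hd h'" "\<omega> h'"] ju kact by auto
  qed
  show "step \<omega> ?k f = Active h \<Longrightarrow> step \<omega> s f = Active h" by (rule 1)
  have 3: "step \<omega> ?k v = Asleep \<longleftrightarrow> v \<in> subtree c \<and> step \<omega> s v = Asleep" for v
    unfolding step_Asleep kill_Asleep asl using woken by blast
  have 4: "step \<omega> s c \<noteq> Asleep" "step \<omega> s [] \<noteq> Asleep" using oth by (auto simp: step_Asleep)
  have 5: "step \<omega> s f \<noteq> Active []" "step \<omega> s f \<noteq> Active [[]]" for f
    using oth by (auto simp: step_Active)
  show "agree_on c (step \<omega> s) (step \<omega> ?k)"
    unfolding agree_on_def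
  proof (intro conjI allI impI)
    fix f h assume "hd h \<in> subtree c"
    then show "step \<omega> s f = Active h \<longleftrightarrow> step \<omega> ?k f = Active h" using 1 2 by metis
  qed (rule 3 4 5)+
qed

text \<open>
  Self-similarity: from the time \<open>e\<close> at which \<open>c'\<close> is entered, the larger process contains a copy
  of the process in the subtree of \<open>c'\<close>, driven by the same choices.
\<close>

lemma run_agree_on:
  assumes ag: "agree_on c' (run c h \<omega> e) (start c' \<eta>)" and nb: "to_neighbours d \<omega>"
    and c: "c' \<noteq> []" "c' \<in> subtree c"
  shows "agree_on c' (run c h \<omega> (e + t)) (run c' \<eta> \<omega> t)"
    and "run c' \<eta> \<omega> t f = Active h' \<Longrightarrow> hd h' \<notin> subtree c' \<Longrightarrow> run c h \<omega> (e + t) f = Active h'"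
proof -
  have ag': "agree_on c' (run c h \<omega> (e + t)) (run c' \<eta> \<omega> t)" for t
  proof (induction t)
    case (Suc t)
    then show ?case using agree_on_step(1)[OF agree_on_kill[OF Suc c(2)] nb c(1)] by simp
  qed (use ag in simp)
  then show "agree_on c' (run c h \<omega> (e + t)) (run c' \<eta> \<omega> t)" .
  show "run c h \<omega> (e + t) f = Active h'" if a: "run c' \<eta> \<omega> t f = Active h'" "hd h' \<notin> subtree c'"
  proof (cases t)
    case 0
    then show ?thesis using a by (auto simp: start_def split: if_splits)
  next
    case (Suc t')
    then show ?thesis
      using agree_on_step(2)[OF agree_on_kill[OF ag'[of t'] c(2)] nb c(1)] a by simp
  qed
qed

text \<open>
  The first jump to a child \<open>k\<close> of \<open>c\<close> creates the starting configuration of the process in its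
  subtree: the subtree was asleep as a whole, and the tie rule lets exactly one frog in.
\<close>

lemma child_entered:
  assumes inv: "entry_inv c s" and sub: "confined c s"
    and nb: "to_neighbours d \<omega>" and c: "c \<noteq> []"
    and before: "s (k # c) = Asleep" and after: "step \<omega> s (k # c) \<noteq> Asleep"
  obtains \<eta> where "entry_history (k # c) \<eta>" "agree_on (k # c) (step \<omega> s) (start (k # c) \<eta>)"
proof -
  let ?c = "k # c"
  obtain g u where j: "jumping \<omega> s g u ?c" using before after by (auto simp: step_Asleep)
  obtain \<eta> where \<eta>: "s g = Active \<eta>" "hd \<eta> = u" "\<omega> \<eta> = ?c" using j by (elim jumping_Active)
  note wfp = woken_from_parent[OF inv sub nb]
  have "\<omega> \<eta> \<in> subtree ?c" by (simp add: \<eta>(3))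
  then have u: "u = c" using wfp(2)[OF before \<eta>(1)] \<eta>(2) by simp
  have ne: "\<eta> \<noteq> []" "last \<eta> = g" using entry_invD(1,2)[OF inv \<eta>(1)] by auto
  have asl: "s w = Asleep" if "w \<in> subtree ?c" for w using entry_invD(4)[OF inv before that] .
  have subc: "w \<in> subtree c" if "w \<in> subtree ?c" for w
    using that subtree_trans[OF subtree_Cons[OF subtree_refl]] by blast
  have gn: "g \<notin> subtree ?c" using asl \<eta>(1) by force
  have "set \<eta> \<inter> subtree ?c = {}" using entry_invD(3)[OF inv \<eta>(1)] asl subc by blast
  then have adm: "entry_history ?c \<eta>" unfolding entry_history_def using ne \<eta> u by auto
  have kd: "?c \<in> children d c"
  proof -
    have "\<omega> \<eta> = tl (hd \<eta>) \<or> \<omega> \<eta> \<in> children d (hd \<eta>)" using nb ne(1) unfolding to_neighbours_def by blast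
    moreover have "?c \<noteq> tl c" by (metis child_notin_subtree subtree_refl subtree_tl)
    ultimately show ?thesis using \<eta> u by auto
  qed
  have uniq: "f = g" if "jumping \<omega> s f u' ?c" for f u'
  proof -
    obtain h where h: "s f = Active h" "hd h = u'" "\<omega> h = ?c" using \<open>jumping \<omega> s f u' ?c\<close> by (elim jumping_Active)
    have "\<omega> h \<in> subtree ?c" by (simp add: h(3))
    then have "u' = c" using wfp(2)[OF before h(1)] h(2) by simp
    then show ?thesis using that j u kd c unfolding jumps_def by auto
  qed
  have into: "\<omega> h = ?c" if "s f = Active h" "\<omega> h \<in> subtree ?c" for f h
    using wfp(1)[OF before that] .
  have sg: "step \<omega> s g = Active (?c # \<eta>)" using \<eta> j u by (auto simp: step_Active)
  have sc: "step \<omega> s ?c = Active [?c]" using before j by (auto simp: step_Active)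
  have so: "step \<omega> s w = Asleep" if w: "w \<in> subtree ?c" "w \<noteq> ?c" for w
  proof -
    have "\<not> jumping \<omega> s f u' w" for f u'
    proof
      assume "jumping \<omega> s f u' w"
      then obtain h where "s f = Active h" "\<omega> h = w" by (elim jumping_Active)
      then show False using into w by blast
    qed
    then show ?thesis using asl[OF w(1)] by (simp add: step_Asleep)
  qed
  have act: "start ?c \<eta> f = Active h" if a: "step \<omega> s f = Active h" and h: "hd h \<in> subtree ?c" for f h
  proof -
    consider "s f = Asleep" "h = [f]" |
      h' where "s f = Active h'" "jumping \<omega> s f (hd h') (\<omega> h')" "h = \<omega> h' # h'"
      using a unfolding step_Active by blast
    then show ?thesis
    proof cases
      case 1
      then have "f = ?c" using so[of f] a h by auto
      then show ?thesis using 1 gn ne by (auto simp: start_def)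
    next
      case 2
      then have "\<omega> h' = ?c" using into h by auto
      then have "f = g" using uniq 2 by simp
      then show ?thesis using 2 \<eta> ne by (auto simp: start_def)
    qed
  qed
  have act': "step \<omega> s f = Active h" if "start ?c \<eta> f = Active h" for f h
    using that sg sc ne by (auto simp: start_def split: if_splits)
  have asl': "start ?c \<eta> v = Asleep \<longleftrightarrow> v \<in> subtree ?c \<and> step \<omega> s v = Asleep" for v
    using so sg sc ne gn by (auto simp: start_def split: if_splits)
  have nil: "[] \<notin> subtree c" using c subtree_length[of "[]" c] by auto
  then have "s [] \<noteq> Asleep" using entry_invD(5)[OF inv] by blast
  then have "step \<omega> s [] \<noteq> Asleep" by (simp add: step_Asleep)
  moreover have "step \<omega> s f \<noteq> Active []" "step \<omega> s f \<noteq> Active [[]]" for f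
    using \<open>s [] \<noteq> Asleep\<close> entry_invD(1)[OF inv] by (auto simp: step_Active)
  ultimately have "agree_on ?c (step \<omega> s) (start ?c \<eta>)"
    unfolding agree_on_def
  proof (intro conjI allI impI)
    fix f h assume "hd h \<in> subtree ?c"
    then show "step \<omega> s f = Active h \<longleftrightarrow> start ?c \<eta> f = Active h" using act act' by metis
  qed (use asl' sc in simp_all)
  then show thesis using that adm by blast
qed

end

section \<open>Entering the children of a vertex\<close>

text \<open>
  The choices that influence the returns from \<open>c\<close> and the next move of each returning frog: those
  made inside the subtree of \<open>c\<close>, and those made at the parent right after leaving the subtree.
\<close>

definition region :: "vertex \<Rightarrow> history set" where
  "region c = {h. hd h \<in> subtree c \<and> h \<noteq> []} \<union> {tl c # c # r | r. True}"

lemma region_siblings: "j \<noteq> k \<Longrightarrow> region (j # c) \<inter> region (k # c) = {}"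
  using subtree_siblings child_notin_subtree unfolding region_def by auto

context frog_tie
begin

text \<open>
  The returns that go on upwards once more, from the parent of \<open>c\<close> to its grandparent.
\<close>

definition ups :: "vertex \<Rightarrow> history \<Rightarrow> (history \<Rightarrow> vertex) \<Rightarrow> nat \<Rightarrow> history set" where
  "ups c h \<omega> t = {h' \<in> returns c h \<omega> t. \<omega> h' = tl (tl c)}"

lemma returns_form: "h' \<in> returns c h \<omega> t \<Longrightarrow> \<exists>r. h' = tl c # c # r"
  unfolding returns_def by blast

lemma finite_ups: "finite (ups c h \<omega> t)"
  unfolding ups_def using finite_returns by simp

lemma child_return_in_run:
  assumes ag: "agree_on (k # c) (run c h \<omega> e) (start (k # c) \<eta>)" and nb: "to_neighbours d \<omega>"
    and h': "h' \<in> returns (k # c) \<eta> \<omega> t"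
  obtains f s where "s \<le> t" "run c h \<omega> (e + s) f = Active h'"
proof -
  obtain s f r where s: "s \<le> t" "run (k # c) \<eta> \<omega> s f = Active h'" "h' = c # (k # c) # r"
    using h' unfolding returns_def by auto
  have "hd h' \<notin> subtree (k # c)" using s(3) child_notin_subtree by simp
  then have "run c h \<omega> (e + s) f = Active h'"
    using run_agree_on(2)[OF ag nb _ subtree_Cons[OF subtree_refl] s(2)] by simp
  then show thesis using that s(1) by blast
qed

lemma up_move:
  assumes "run c h \<omega> s f = Active (c # r)" "\<omega> (c # r) = tl c" "c \<noteq> []"
  shows "run c h \<omega> (Suc s) f = Active (tl c # c # r)"
  using assms parent_notin_children[of c d]
  by (auto simp: step_Active jumps_def attempts_def)

text \<open>
  A frog that has come back from a child of \<open>c\<close> and moves up is a return from \<open>c\<close>.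
\<close>

lemma ups_child_subset:
  assumes ag: "agree_on (k # c) (run c h \<omega> e) (start (k # c) \<eta>)" and nb: "to_neighbours d \<omega>"
    and c: "c \<noteq> []" and t: "e + t < t'"
  shows "(\<lambda>h'. tl c # h') ` ups (k # c) \<eta> \<omega> t \<subseteq> returns c h \<omega> t'"
proof clarify
  fix h' assume "h' \<in> ups (k # c) \<eta> \<omega> t"
  then have h': "h' \<in> returns (k # c) \<eta> \<omega> t" "\<omega> h' = tl c" by (auto simp: ups_def)
  obtain r where r: "h' = c # r" using returns_form[OF h'(1)] by auto
  obtain f s where fs: "s \<le> t" "run c h \<omega> (e + s) f = Active (c # r)"
    using child_return_in_run[OF ag nb h'(1)] r by metis
  have "run c h \<omega> (Suc (e + s)) f = Active (tl c # c # r)"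
    by (rule up_move[OF fs(2)]) (use h' r c in auto)
  then show "tl c # h' \<in> returns c h \<omega> t'"
    unfolding r by (rule returnsI) (use fs t in simp)
qed

text \<open>
  As long as a child sleeps, an attempt to enter it succeeds for the frog chosen by the tie rule.
\<close>

lemma attempted_child_awake:
  assumes "run c h \<omega> t f = Active h'" "hd h' = c" "\<omega> h' = k # c" "k < d" "c \<noteq> []"
  shows "run c h \<omega> (Suc t) (k # c) \<noteq> Asleep"
proof
  let ?s = "kill c (run c h \<omega> t)"
  assume "run c h \<omega> (Suc t) (k # c) = Asleep"
  then have a: "?s (k # c) = Asleep" "\<And>g u. \<not> jumping \<omega> ?s g u (k # c)" by (simp_all add: step_Asleep)
  have "attempts \<omega> ?s f c (k # c)" unfolding attempts_def using assms by auto
  then have "{g. attempts \<omega> ?s g c (k # c)} \<noteq> {}" by blast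
  then have "tie (k # c) {g. attempts \<omega> ?s g c (k # c)} \<in> {g. attempts \<omega> ?s g c (k # c)}"
    using tie[unfolded tie_rule_def, rule_format, of "{g. attempts \<omega> ?s g c (k # c)}" "k # c"] by (simp only: simp_thms)
  then have "jumping \<omega> ?s (tie (k # c) {g. attempts \<omega> ?s g c (k # c)}) c (k # c)"
    unfolding jumps_def mem_Collect_eq using a(1) by blast
  then show False using a(2) by blast
qed

definition entered :: "vertex \<Rightarrow> (nat \<Rightarrow> configuration) \<Rightarrow> nat \<Rightarrow> nat \<Rightarrow> history \<Rightarrow> bool" where
  "entered c x k e \<eta> \<longleftrightarrow> x e (k # c) = Asleep \<and> x (Suc e) (k # c) \<noteq> Asleep \<and>
     (\<exists>f. x (Suc e) f = Active ((k # c) # \<eta>)) \<and> \<eta> \<noteq> []"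

text \<open>
  The history with which the child \<open>k\<close> of \<open>c\<close> is entered, if this happens by time \<open>T + 1\<close>, as a
  function of the choices.  The entry time and the history are then unique, so any choice operator
  picks the right value.
\<close>

definition entrant :: "vertex \<Rightarrow> history \<Rightarrow> nat \<Rightarrow> nat \<Rightarrow> (history \<Rightarrow> vertex) \<Rightarrow> history" where
  "entrant c h k T \<omega> = (SOME \<eta>. \<exists>e\<le>T. entered c (run c h \<omega>) k e \<eta>)"

lemma entrant_enters:
  assumes h: "entry_history c h" and nb: "to_neighbours d \<omega>" and aw: "run c h \<omega> (Suc T) (k # c) \<noteq> Asleep"
  obtains e where "entry_history (k # c) (entrant c h k T \<omega>)" "e \<le> T"
    "agree_on (k # c) (run c h \<omega> (Suc e)) (start (k # c) (entrant c h k T \<omega>))"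
proof -
  have c: "c \<noteq> []" "k # c \<noteq> last h" "h \<noteq> []"
    using entry_historyD[OF h] subtree_Cons[OF subtree_refl[of c], of k] by auto
  have s0: "run c h \<omega> 0 (k # c) = Asleep"
    using c by (simp add: start_def subtree_Cons)
  have enters: "\<exists>\<eta>. entry_history (k # c) \<eta> \<and> agree_on (k # c) (run c h \<omega> (Suc e)) (start (k # c) \<eta>)"
    if "run c h \<omega> e (k # c) = Asleep" "run c h \<omega> (Suc e) (k # c) \<noteq> Asleep" for e
    using child_entered[OF entry_inv_kill[OF entry_inv_run[OF h nb]] confined_kill nb c(1), of e k] that
    by (metis kill_Asleep run.simps(2))
  have starts: "start (k # c) \<eta> (last \<eta>) = Active ((k # c) # \<eta>)" for \<eta>
    by (simp add: start_def)
  have "\<exists>e\<le>T. run c h \<omega> e (k # c) = Asleep \<and> run c h \<omega> (Suc e) (k # c) \<noteq> Asleep"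
  proof (rule ccontr)
    assume no: "\<not> ?thesis"
    have "e \<le> Suc T \<Longrightarrow> run c h \<omega> e (k # c) = Asleep" for e
      using s0 no by (induction e) auto
    then show False using aw by blast
  qed
  then obtain e where e: "e \<le> T" "run c h \<omega> e (k # c) = Asleep" "run c h \<omega> (Suc e) (k # c) \<noteq> Asleep" by blast
  then obtain \<eta> where \<eta>: "entry_history (k # c) \<eta>" "agree_on (k # c) (run c h \<omega> (Suc e)) (start (k # c) \<eta>)"
    using enters by blast
  have "run c h \<omega> (Suc e) (last \<eta>) = Active ((k # c) # \<eta>)"
    using \<eta>(2) starts[of \<eta>] unfolding agree_on_def by (metis list.sel(1) subtree_refl)
  then have "\<exists>\<eta>. \<exists>e\<le>T. entered c (run c h \<omega>) k e \<eta>"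
    unfolding entered_def using e \<eta>(1) unfolding entry_history_def by blast
  then have "\<exists>e\<le>T. entered c (run c h \<omega>) k e (entrant c h k T \<omega>)"
    unfolding entrant_def by (rule someI_ex)
  then obtain e' where e': "e' \<le> T" "entered c (run c h \<omega>) k e' (entrant c h k T \<omega>)" by blast
  then have "run c h \<omega> e' (k # c) = Asleep" "run c h \<omega> (Suc e') (k # c) \<noteq> Asleep"
    unfolding entered_def by blast+
  then obtain \<eta>' where \<eta>': "entry_history (k # c) \<eta>'" "agree_on (k # c) (run c h \<omega> (Suc e')) (start (k # c) \<eta>')"
    using enters by blast
  obtain f where f: "run c h \<omega> (Suc e') f = Active ((k # c) # entrant c h k T \<omega>)" "entrant c h k T \<omega> \<noteq> []"
    using e'(2) unfolding entered_def by blast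
  then have "start (k # c) \<eta>' f = Active ((k # c) # entrant c h k T \<omega>)"
    using \<eta>'(2) unfolding agree_on_def by (metis list.sel(1) subtree_refl)
  then have "entrant c h k T \<omega> = \<eta>'" using f(2) by (auto simp: start_def split: if_splits)
  then show thesis using that \<eta>' e' by blast
qed

text \<open>
  Until \<open>k\<close> is entered, no active frog has visited it.  So none of the choices in its region has been
  read, and the step of entry does not read them either.
\<close>

lemma run_cong_before_entry:
  assumes h: "entry_history c h" and nb: "to_neighbours d \<omega>"
    and eq: "\<And>h'. h' \<notin> region (k # c) \<Longrightarrow> \<omega> h' = \<omega>' h'"
    and asl: "run c h \<omega> t (k # c) = Asleep"
  shows "run c h \<omega>' t = run c h \<omega> t" "run c h \<omega>' (Suc t) = run c h \<omega> (Suc t)"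
proof -
  have st: "step \<omega> (kill c (run c h \<omega> t)) = step \<omega>' (kill c (run c h \<omega> t))"
    if asl: "run c h \<omega> t (k # c) = Asleep" for t
  proof (rule step_cong)
    fix f h' assume "kill c (run c h \<omega> t) f = Active h'"
    then have a: "run c h \<omega> t f = Active h'" "hd h' \<in> subtree c" by auto
    note inv = entry_inv_run[OF h nb, of t]
    have ne: "h' \<noteq> []" using entry_invD(1)[OF inv a(1)] .
    have aw: "w \<notin> subtree (k # c)" if "w \<in> set h'" for w
    proof
      assume w: "w \<in> subtree (k # c)"
      then have "w \<in> subtree c" using subtree_trans[OF subtree_Cons[OF subtree_refl]] by blast
      then show False using entry_invD(3)[OF inv a(1) that] entry_invD(4)[OF inv asl w] by blast
    qed
    have "h' \<notin> region (k # c)"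
      using aw[of "hd h'"] aw[of "k # c"] ne unfolding region_def by auto
    then show "\<omega> h' = \<omega>' h'" by (rule eq)
  qed
  have r: "run c h \<omega>' t = run c h \<omega> t" if "run c h \<omega> t (k # c) = Asleep" for t
    using that
  proof (induction t)
    case (Suc t)
    then have a: "run c h \<omega> t (k # c) = Asleep" using run_awake_mono[of c h \<omega> t "k # c" "Suc t"] by auto
    then show ?case using Suc.IH st by simp
  qed simp
  show "run c h \<omega>' t = run c h \<omega> t" using r asl .
  then show "run c h \<omega>' (Suc t) = run c h \<omega> (Suc t)" using st[OF asl] by simp
qed

lemma entrant_cong_outside_region:
  assumes h: "entry_history c h" and nb: "to_neighbours d \<omega>" "to_neighbours d \<omega>'"
    and eq: "\<And>h'. h' \<notin> region (k # c) \<Longrightarrow> \<omega> h' = \<omega>' h'"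
  shows "entrant c h k T \<omega> = entrant c h k T \<omega>'"
proof -
  have "entered c (run c h \<omega>'') k e \<eta>"
    if "entered c (run c h \<omega>') k e \<eta>" "to_neighbours d \<omega>'" "\<And>h'. h' \<notin> region (k # c) \<Longrightarrow> \<omega>' h' = \<omega>'' h'"
    for \<omega>' \<omega>'' e \<eta>
  proof -
    have "run c h \<omega>' e (k # c) = Asleep" using that(1) unfolding entered_def by blast
    note same = run_cong_before_entry[OF h that(2,3) this]
    show ?thesis using that(1) by (simp only: entered_def same simp_thms)
  qed
  then have "entered c (run c h \<omega>) k e \<eta> \<longleftrightarrow> entered c (run c h \<omega>') k e \<eta>" for e \<eta>
    using nb eq by metis
  then show ?thesis unfolding entrant_def by simp
qed

text \<open>
  The first step reads only the choices of the entering frog and of the frog woken at \<open>c\<close>.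
\<close>

lemma entrant_cong_first_step:
  assumes "\<omega> (c # h) = \<omega>' (c # h)" "\<omega> [c] = \<omega>' [c]"
  shows "entrant c h k 0 \<omega> = entrant c h k 0 \<omega>'"
proof -
  have "run c h \<omega> (Suc 0) = run c h \<omega>' (Suc 0)"
    unfolding run.simps by (rule step_cong) (use assms in \<open>auto simp: start_def split: if_splits\<close>)
  then have "entered c (run c h \<omega>) k 0 \<eta> \<longleftrightarrow> entered c (run c h \<omega>') k 0 \<eta>" for \<eta>
    unfolding entered_def by simp
  then show ?thesis unfolding entrant_def by simp
qed

lemma finitely_determined_entrant: "finitely_determined (entrant c h k T)"
proof -
  define G where "G x = (SOME \<eta>. \<exists>e\<le>T. entered c x k e \<eta>)" for x
  have "finitely_determined (\<lambda>\<omega> e. if e \<in> {..Suc T} then run c h \<omega> e else start c h)"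
    by (rule finitely_determined_family) (simp_all add: finitely_determined_run)
  then have "finitely_determined (\<lambda>\<omega>. G (\<lambda>e. if e \<in> {..Suc T} then run c h \<omega> e else start c h))"
    by (rule finitely_determined_comp)
  moreover have "G (\<lambda>e. if e \<in> {..Suc T} then run c h \<omega> e else start c h) = entrant c h k T \<omega>" for \<omega>
    unfolding G_def entrant_def entered_def by (rule arg_cong[where f=Eps]) (auto simp: fun_eq_iff)
  ultimately show ?thesis by simp
qed

lemma finitely_determined_returns: "finitely_determined (\<lambda>\<omega>. returns c h \<omega> t)"
proof -
  define G where "G x = {h'. \<exists>s\<le>t. \<exists>f r. x s f = Active h' \<and> h' = tl c # c # r}" for x :: "nat \<Rightarrow> configuration"
  have "finitely_determined (\<lambda>\<omega> s. if s \<in> {..t} then run c h \<omega> s else start c h)"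
    by (rule finitely_determined_family) (simp_all add: finitely_determined_run)
  then have "finitely_determined (\<lambda>\<omega>. G (\<lambda>s. if s \<in> {..t} then run c h \<omega> s else start c h))"
    by (rule finitely_determined_comp)
  moreover have "G (\<lambda>s. if s \<in> {..t} then run c h \<omega> s else start c h) = returns c h \<omega> t" for \<omega>
    unfolding G_def returns_def by auto
  ultimately show ?thesis by simp
qed

lemma finitely_determined_moves:
  "finitely_determined (\<lambda>\<omega>. restrict \<omega> (returns c h \<omega> t))"
proof -
  have "finitely_determined (\<lambda>\<omega>. (if finite R then restrict \<omega> R else undefined))" for R :: "history set"
    by (cases "finite R") (auto simp: finitely_determined_const intro: finitely_determined_restrict)
  then have "finitely_determined (\<lambda>\<omega>. (\<lambda>R \<omega>. if finite R then restrict \<omega> R else undefined) (returns c h \<omega> t) \<omega>)"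
    by (rule finitely_determined_bind[OF finitely_determined_returns])
  then show ?thesis by (simp add: finite_returns)
qed

lemma finitely_determined_ups: "finitely_determined (\<lambda>\<omega>. ups c h \<omega> t)"
proof -
  have "ups c h \<omega> t = (\<lambda>R m. {h' \<in> R. m h' = tl (tl c)}) (returns c h \<omega> t) (restrict \<omega> (returns c h \<omega> t))" for \<omega>
    unfolding ups_def by auto
  then show ?thesis
    using finitely_determined_comp2[OF finitely_determined_returns finitely_determined_moves,
        of "\<lambda>R m. {h' \<in> R. m h' = tl (tl c)}" c h t c h t] by simp
qed

lemma ups_cong:
  assumes "\<And>h'. h' \<in> region c \<Longrightarrow> \<omega> h' = \<omega>' h'"
  shows "returns c h \<omega> t = returns c h \<omega>' t" "ups c h \<omega> t = ups c h \<omega>' t"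
    "\<omega> ` returns c h \<omega> t = \<omega>' ` returns c h \<omega>' t"
proof -
  show R: "returns c h \<omega> t = returns c h \<omega>' t"
    by (rule returns_cong) (use assms in \<open>auto simp: region_def\<close>)
  have eq: "\<omega> h' = \<omega>' h'" if "h' \<in> returns c h \<omega>' t" for h'
    using returns_form[OF that] assms by (auto simp: region_def)
  show "ups c h \<omega> t = ups c h \<omega>' t" unfolding ups_def R using eq by auto
  show "\<omega> ` returns c h \<omega> t = \<omega>' ` returns c h \<omega>' t" unfolding R using eq by (rule image_cong[OF refl])
qed

text \<open>
  The pathwise comparison behind the recursion.  Up to three disjoint sets of returns from \<open>c\<close> are
  exhibited: the frog of \<open>c\<close> if it moves up at once, and the frogs that go up after coming back from
  \<open>j\<close> or from a second child \<open>k\<close>.  Child \<open>j\<close> is entered at time \<open>1\<close>, and its returns up to its local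
  time \<open>t\<close> have made their next move by time \<open>t + 2\<close>; so \<open>k\<close> is entered by then, and the frogs returning
  from \<open>k\<close> up to its local time \<open>t\<close> have moved on by time \<open>2 t + 3\<close>.
\<close>

lemma card_returns_ge:
  assumes h: "entry_history c h" and nb: "to_neighbours d \<omega>"
    and j: "\<omega> (c # h) = j # c" "j < d"
    and \<eta>: "\<eta> = entrant c h j 0 \<omega>"
  shows "entry_history (j # c) \<eta>"
    and "(if \<omega> [c] = tl c then 1 else 0) + card (ups (j # c) \<eta> \<omega> t) \<le> card (returns c h \<omega> (2 * t + 3))"
    and "\<lbrakk>k \<noteq> j; k < d; \<omega> [c] = k # c \<or> k # c \<in> \<omega> ` returns (j # c) \<eta> \<omega> t; \<eta>' = entrant c h k (t + 1) \<omega>\<rbrakk> \<Longrightarrow>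
      entry_history (k # c) \<eta>' \<and> (if \<omega> [c] = tl c then 1 else 0) + card (ups (j # c) \<eta> \<omega> t)
        + card (ups (k # c) \<eta>' \<omega> t) \<le> card (returns c h \<omega> (2 * t + 3))"
proof -
  have c: "c \<noteq> []" "c \<noteq> last h" "h \<noteq> []"
    using entry_historyD[OF h] subtree_refl[of c] by auto
  have s0: "run c h \<omega> 0 (last h) = Active (c # h)" "run c h \<omega> 0 c = Active [c]"
    using c by (auto simp: start_def)
  let ?R = "returns c h \<omega> (2 * t + 3)"
  define A where "A = (if \<omega> [c] = tl c then {[tl c, c]} else {})"
  define B where "B = (\<lambda>h'. tl c # h') ` ups (j # c) \<eta> \<omega> t"
  have A: "A \<subseteq> ?R"
    using up_move[of c h \<omega> 0 c "[]"] s0 c returnsI[of c h \<omega> "Suc 0" c "[]" "2 * t + 3"]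
    by (auto simp: A_def)
  have aw: "run c h \<omega> (Suc 0) (j # c) \<noteq> Asleep"
    by (rule attempted_child_awake[OF s0(1)]) (use j c in auto)
  obtain e where e: "entry_history (j # c) \<eta>" "e \<le> 0" "agree_on (j # c) (run c h \<omega> (Suc e)) (start (j # c) \<eta>)"
    using entrant_enters[OF h nb aw] unfolding \<eta> by blast
  then show "entry_history (j # c) \<eta>" by simp
  have ag: "agree_on (j # c) (run c h \<omega> (Suc 0)) (start (j # c) \<eta>)" using e by simp
  have B: "B \<subseteq> ?R" unfolding B_def by (rule ups_child_subset[OF ag nb c(1)]) simp
  have inj: "card ((\<lambda>h'. tl c # h') ` X) = card X" for X :: "history set"
    by (rule card_image) (simp add: inj_on_def)
  have finB: "finite B" "finite A" unfolding B_def A_def by (auto intro: finite_ups)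
  have upsD: "h' \<in> ups (i # c) \<zeta> \<omega> t \<Longrightarrow> \<exists>r. h' = c # (i # c) # r" for h' i \<zeta>
    using returns_form[of h' "i # c"] unfolding ups_def by auto
  have disj: "A \<inter> B = {}"
    using upsD[of "[c]" j \<eta>] by (auto simp: A_def B_def)
  have AB: "card (A \<union> B) = (if \<omega> [c] = tl c then 1 else 0) + card (ups (j # c) \<eta> \<omega> t)"
    using disj finB by (subst card_Un_disjoint) (auto simp: A_def B_def inj)
  show "(if \<omega> [c] = tl c then 1 else 0) + card (ups (j # c) \<eta> \<omega> t) \<le> card ?R"
    unfolding AB[symmetric] by (rule card_mono[OF finite_returns]) (use A B in simp)
  assume k: "k \<noteq> j" "k < d" "\<omega> [c] = k # c \<or> k # c \<in> \<omega> ` returns (j # c) \<eta> \<omega> t" "\<eta>' = entrant c h k (t + 1) \<omega>"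
  have awk: "run c h \<omega> (Suc (t + 1)) (k # c) \<noteq> Asleep"
    using k(3)
  proof
    assume "\<omega> [c] = k # c"
    then have "run c h \<omega> (Suc 0) (k # c) \<noteq> Asleep"
      by (intro attempted_child_awake[OF s0(2)]) (use k c in auto)
    then show ?thesis by (rule run_awake_mono) simp
  next
    assume "k # c \<in> \<omega> ` returns (j # c) \<eta> \<omega> t"
    then obtain h' where h': "h' \<in> returns (j # c) \<eta> \<omega> t" "\<omega> h' = k # c" by auto
    then obtain f s where fs: "s \<le> t" "run c h \<omega> (Suc 0 + s) f = Active h'"
      using child_return_in_run[OF ag nb] by metis
    have "run c h \<omega> (Suc (Suc 0 + s)) (k # c) \<noteq> Asleep"
      by (rule attempted_child_awake[OF fs(2)]) (use returns_form[OF h'(1)] h' k c in auto)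
    then show ?thesis by (rule run_awake_mono) (use fs in simp)
  qed
  obtain e' where e': "entry_history (k # c) \<eta>'" "e' \<le> t + 1" "agree_on (k # c) (run c h \<omega> (Suc e')) (start (k # c) \<eta>')"
    using entrant_enters[OF h nb awk] unfolding k(4) by blast
  define C where "C = (\<lambda>h'. tl c # h') ` ups (k # c) \<eta>' \<omega> t"
  have C: "C \<subseteq> ?R" unfolding C_def by (rule ups_child_subset[OF e'(3) nb c(1)]) (use e' in simp)
  have "h' \<notin> ups (k # c) \<eta>' \<omega> t" if "h' \<in> ups (j # c) \<eta> \<omega> t" for h'
    using upsD[OF that] upsD[of h' k \<eta>'] k(1) by auto
  then have "(A \<union> B) \<inter> C = {}"
    using upsD[of "[c]" k \<eta>'] by (auto simp: A_def B_def C_def)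
  then have ABC: "card (A \<union> B \<union> C) = (if \<omega> [c] = tl c then 1 else 0) + card (ups (j # c) \<eta> \<omega> t) + card (ups (k # c) \<eta>' \<omega> t)"
    using AB finB by (subst card_Un_disjoint) (auto simp: C_def inj finite_ups)
  have "card (A \<union> B \<union> C) \<le> card ?R" by (rule card_mono[OF finite_returns]) (use A B C in simp)
  then show "entry_history (k # c) \<eta>' \<and> (if \<omega> [c] = tl c then 1 else 0) + card (ups (j # c) \<eta> \<omega> t)
        + card (ups (k # c) \<eta>' \<omega> t) \<le> card ?R" using e'(1) ABC by simp
qed

end

section \<open>Generating functions of the number of returns\<close>

lemma finite_children [simp]: "finite (children d v)" and children_nonempty: "0 < d \<Longrightarrow> children d v \<noteq> {}"
  and card_children: "card (children d v) = d"
  by (auto simp: children_def card_image inj_on_def)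

context frog_tie
begin

text \<open>
  The value of the drift at which a frog that last moved upwards goes on upwards with
  probability \<open>1/2\<close>.
\<close>

definition p :: real where "p = (real d - 1) / (2 * real d - 1)"

lemma p_bounds: "0 < p" "p < 1" "(1 - p) * (real d - 1) / real d = p" "p + (1 - p) / real d = 1 - p" "1/3 \<le> p"
proof -
  define D where "D = 2 * real d - 1"
  have D: "3 \<le> D" "real d = (D + 1) / 2" "p = (D - 1) / (2 * D)"
    using d2 by (simp_all add: D_def p_def field_simps)
  show "0 < p" "p < 1" "1/3 \<le> p" using D(1) unfolding D(3) by (simp_all add: field_simps)
  have p: "1 - p = real d / D" "p = (real d - 1) / D" using D by (simp_all add: field_simps)
  have q: "(1 - p) / real d = 1 / D" using d2 unfolding p(1) by simp
  have "(1 - p) * (real d - 1) / real d = (1 - p) / real d * (real d - 1)" by simp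
  also have "\<dots> = 1 / D * (real d - 1)" unfolding q ..
  also have "\<dots> = p" using p(2) by simp
  finally show "(1 - p) * (real d - 1) / real d = p" .
  show "p + (1 - p) / real d = 1 - p" unfolding q p(1) unfolding p(2) using d2 by (simp add: add_divide_distrib[symmetric])
qed

lemma up_prob_p: "up_prob d p = 1 / 2"
  using p_bounds by (simp add: up_prob_def)

sublocale W: pmf_product "next_site d p" .

abbreviation \<mu> :: "(history \<Rightarrow> vertex) measure" where "\<mu> \<equiv> W.law"

lemma frog_space_eq: "frog_space d p = \<mu>"
  by (simp add: frog_space_def W.law_def)

definition legal :: "(history \<Rightarrow> vertex) \<Rightarrow> bool" where
  "legal \<omega> \<longleftrightarrow> (\<forall>h. \<omega> h \<in> set_pmf (next_site d p h))"

lemma AE_legal: "AE \<omega> in \<mu>. legal \<omega>"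
  unfolding legal_def by (rule W.AE_coordinates_in_support)

lemma legal_mix: "legal \<omega> \<Longrightarrow> legal \<omega>' \<Longrightarrow> legal (mix K \<omega> \<omega>')"
  by (simp add: legal_def mix_def)

lemma children_minus_nonempty: "children d v - {u} \<noteq> {}"
proof
  assume "children d v - {u} = {}"
  then have "children d v \<subseteq> {u}" by blast
  then have "card (children d v) \<le> 1" using card_mono[of "{u}"] by force
  then show False using d2 by (simp add: card_children)
qed

lemma children_nonempty': "children d v \<noteq> {}"
  using d2 children_nonempty by simp

lemma set_pmf_children [simp]:
  "set_pmf (pmf_of_set (children d v)) = children d v"
  "set_pmf (pmf_of_set (children d v - {u})) = children d v - {u}"
  by (simp_all add: set_pmf_of_set[OF children_nonempty'] set_pmf_of_set[OF children_minus_nonempty])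

lemma legal_to_neighbours:
  assumes "legal \<omega>"
  shows "to_neighbours d \<omega>"
  unfolding to_neighbours_def
proof (intro allI impI)
  fix h :: history assume "h \<noteq> []"
  have "set_pmf (next_site d p h) \<subseteq> insert (tl (hd h)) (children d (hd h))"
  proof (cases h)
    case (Cons v h')
    then show ?thesis by (cases h') (auto split: if_splits)
  qed (use \<open>h \<noteq> []\<close> in simp)
  then show "\<omega> h = tl (hd h) \<or> \<omega> h \<in> children d (hd h)"
    using assms unfolding legal_def by blast
qed

lemma next_site_downward:
  "entry_history c h \<Longrightarrow> next_site d p (c # h) = pmf_of_set (children d c)"
  using parent_notin_children[of c d] entry_historyD[of c h] by (cases h) auto

lemma legal_downward: "legal \<omega> \<Longrightarrow> entry_history c h \<Longrightarrow> \<omega> (c # h) \<in> children d c"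
  unfolding legal_def using next_site_downward[of c h] set_pmf_children(1) by metis

lemma legal_return:
  assumes "legal \<omega>" "k < d"
  shows "\<omega> (c # (k # c) # r) \<noteq> k # c"
proof -
  have "k # c \<in> children d c" "k # c \<noteq> tl c"
    using assms(2) parent_notin_children[of c d] by (auto simp: children_iff)
  then have "k # c \<notin> set_pmf (next_site d p (c # (k # c) # r))"
    by auto
  then show ?thesis using assms(1) unfolding legal_def by metis
qed

lemma pmf_wake_up:
  assumes "c \<noteq> []"
  shows "pmf (next_site d p [c]) (tl c) = p"
  using assms p_bounds parent_notin_children[of c d] children_nonempty'
  by (simp add: pmf_bind pmf_of_set)

lemma pmf_wake_down:
  assumes "c \<noteq> []" "v \<in> children d c"
  shows "pmf (next_site d p [c]) v = (1 - p) / real d"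
proof -
  have "v \<noteq> tl c" using assms parent_notin_children by metis
  then show ?thesis
    using assms p_bounds by (simp add: pmf_bind pmf_of_set children_nonempty' card_children)
qed

lemma pmf_return_up:
  assumes "k < d"
  shows "pmf (next_site d p (c # (k # c) # r)) (tl c) = 1 / 2"
proof -
  have "k # c \<in> children d c" "tl c \<notin> children d c - {k # c}"
    using assms parent_notin_children[of c d] by (auto simp: children_iff)
  then show ?thesis
    by (simp add: pmf_bind up_prob_p pmf_of_set[OF children_minus_nonempty])
qed

lemma expectation_if_eq:
  "measure_pmf.expectation q (\<lambda>v. if v = a then x else (y :: real)) = y + (x - y) * pmf q a"
proof -
  have "measure_pmf.expectation q (\<lambda>v. if v = a then x else y) =
      measure_pmf.expectation q (\<lambda>v. y + (x - y) * indicator {a} v)"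
    by (rule Bochner_Integration.integral_cong) auto
  also have "\<dots> = y + (x - y) * pmf q a"
    by (subst Bochner_Integration.integral_add) (auto simp: measure_pmf_single integrable_indicator_iff measure_pmf.emeasure_eq_measure)
  finally show ?thesis .
qed

text \<open>
  The supremum over all ways of entering a subtree of the generating function of the number of
  returns.  Through the tie rule, the law may depend on the entry; the supremum makes it
  unnecessary to compare these laws.
\<close>

definition \<phi> :: "nat \<Rightarrow> real \<Rightarrow> real" where
  "\<phi> t x = (SUP (c, h)\<in>{(c, h). entry_history c h}. \<integral>\<omega>. x ^ card (returns c h \<omega> t) \<partial>\<mu>)"

lemma fd_returns_power: "finitely_determined (\<lambda>\<omega>. x ^ card (returns c h \<omega> t) :: real)"
  by (rule finitely_determined_comp[OF finitely_determined_returns])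

lemma fd_ups_power: "finitely_determined (\<lambda>\<omega>. x ^ card (ups c h \<omega> t) :: real)"
  by (rule finitely_determined_comp[OF finitely_determined_ups])

lemma expectation_bounds:
  fixes f :: "(history \<Rightarrow> vertex) \<Rightarrow> real"
  assumes "finitely_determined f" "\<And>\<omega>. 0 \<le> f \<omega>" "\<And>\<omega>. f \<omega> \<le> 1"
  shows "0 \<le> integral\<^sup>L \<mu> f" "integral\<^sup>L \<mu> f \<le> 1" "integrable \<mu> f"
proof -
  show i: "integrable \<mu> f"
    by (rule W.integrable_finitely_determined[OF assms(1), of 1]) (use assms(2,3) in simp)
  show "0 \<le> integral\<^sup>L \<mu> f" using assms by simp
  have "integral\<^sup>L \<mu> f \<le> (\<integral>\<omega>. 1 \<partial>\<mu>)" using assms i by (intro integral_mono) auto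
  then show "integral\<^sup>L \<mu> f \<le> 1" by simp
qed

lemma entry_history_exists: "entry_history [0] [[]]"
  unfolding entry_history_def subtree_def by simp

lemma \<phi>_upper:
  assumes "entry_history c h" "0 \<le> x" "x \<le> 1"
  shows "(\<integral>\<omega>. x ^ card (returns c h \<omega> t) \<partial>\<mu>) \<le> \<phi> t x"
  unfolding \<phi>_def
proof (rule cSUP_upper2[where x="(c, h)"])
  show "bdd_above ((\<lambda>(c, h). \<integral>\<omega>. x ^ card (returns c h \<omega> t) \<partial>\<mu>) ` {(c, h). entry_history c h})"
    using expectation_bounds(2)[OF fd_returns_power] assms
    by (intro bdd_aboveI2[of _ _ 1]) (auto simp: power_le_one)
qed (use assms in auto)

lemma \<phi>_least:
  assumes "\<And>c h. entry_history c h \<Longrightarrow> (\<integral>\<omega>. x ^ card (returns c h \<omega> t) \<partial>\<mu>) \<le> b"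
  shows "\<phi> t x \<le> b"
  unfolding \<phi>_def by (rule cSUP_least) (use assms entry_history_exists in auto)

lemma \<phi>_bounds:
  assumes "0 \<le> x" "x \<le> 1"
  shows "0 \<le> \<phi> t x" "\<phi> t x \<le> 1"
proof -
  show "\<phi> t x \<le> 1"
    by (rule \<phi>_least, rule expectation_bounds(2)[OF fd_returns_power]) (use assms in \<open>auto simp: power_le_one\<close>)
  have "0 \<le> (\<integral>\<omega>. x ^ card (returns [0] [[]] \<omega> t) \<partial>\<mu>)" using assms by simp
  also have "\<dots> \<le> \<phi> t x" by (rule \<phi>_upper[OF entry_history_exists assms])
  finally show "0 \<le> \<phi> t x" .
qed

lemma \<phi>_mono:
  assumes "0 \<le> x" "x \<le> y" "y \<le> 1"
  shows "\<phi> t x \<le> \<phi> t y"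
proof (rule \<phi>_least)
  fix c h assume h: "entry_history c h"
  have "(\<integral>\<omega>. x ^ card (returns c h \<omega> t) \<partial>\<mu>) \<le> (\<integral>\<omega>. y ^ card (returns c h \<omega> t) \<partial>\<mu>)"
    using assms by (intro integral_mono expectation_bounds(3)[OF fd_returns_power] power_mono) (auto simp: power_le_one)
  also have "\<dots> \<le> \<phi> t y" by (rule \<phi>_upper[OF h]) (use assms in auto)
  finally show "(\<integral>\<omega>. x ^ card (returns c h \<omega> t) \<partial>\<mu>) \<le> \<phi> t y" .
qed

lemma \<phi>_decreasing:
  assumes "0 \<le> x" "x \<le> 1" "t \<le> t'"
  shows "\<phi> t' x \<le> \<phi> t x"
proof (rule \<phi>_least)
  fix c h assume h: "entry_history c h"
  have "(\<integral>\<omega>. x ^ card (returns c h \<omega> t') \<partial>\<mu>) \<le> (\<integral>\<omega>. x ^ card (returns c h \<omega> t) \<partial>\<mu>)"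
    using assms returns_mono[OF assms(3)]
    by (intro integral_mono expectation_bounds(3)[OF fd_returns_power] power_decreasing card_mono finite_returns)
      (auto simp: power_le_one)
  also have "\<dots> \<le> \<phi> t x" by (rule \<phi>_upper[OF h]) (use assms in auto)
  finally show "(\<integral>\<omega>. x ^ card (returns c h \<omega> t') \<partial>\<mu>) \<le> \<phi> t x" .
qed

text \<open>
  The moves of the returning frogs at \<open>c\<close> are independent of the set of returns and equally likely to
  go up or down.  So giving weight \<open>a\<close> to upward and \<open>b\<close> to downward moves amounts to giving the
  average weight to each return.
\<close>

lemma expectation_returns_prod:
  assumes \<eta>: "entry_history (k # c) \<eta>" and k: "k < d" and a: "0 \<le> a" "a \<le> 1" and b: "0 \<le> b" "b \<le> 1"
  shows "(\<integral>\<omega>. (\<Prod>h'\<in>returns (k # c) \<eta> \<omega> t. if \<omega> h' = tl c then a else b) \<partial>\<mu>) \<le> \<phi> t ((a + b) / 2)"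
proof -
  let ?g = "\<lambda>v. if v = tl c then a else b"
  let ?R = "\<lambda>\<omega>. returns (k # c) \<eta> \<omega> t"
  let ?f = "\<lambda>\<omega>. \<Prod>h'\<in>?R \<omega>. ?g (\<omega> h')"
  define K where "K = {h :: history. hd h = c \<and> h \<noteq> []}"
  have "finitely_determined (\<lambda>\<omega>. (\<lambda>R m. \<Prod>h'\<in>R. ?g (m h')) (?R \<omega>) (restrict \<omega> (?R \<omega>)))"
    by (rule finitely_determined_comp2[OF finitely_determined_returns finitely_determined_moves])
  then have fd: "finitely_determined ?f" by simp
  have bd: "\<bar>?f \<omega>\<bar> \<le> 1" for \<omega>
    using a b by (subst abs_of_nonneg) (auto intro!: prod_nonneg prod_le_1)
  have R: "?R (mix K \<omega> \<omega>') = ?R \<omega>" for \<omega> \<omega>'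
    by (rule returns_cong) (use child_notin_subtree in \<open>auto simp: mix_def K_def\<close>)
  have inK: "h' \<in> K" if "h' \<in> ?R \<omega>" for h' \<omega>
    using returns_form[OF that] by (auto simp: K_def)
  have "(\<integral>\<omega>. ?f \<omega> \<partial>\<mu>) = (\<integral>\<omega>. (\<integral>\<omega>'. ?f (mix K \<omega> \<omega>') \<partial>\<mu>) \<partial>\<mu>)"
    by (rule W.expectation_mix(1)[OF fd bd])
  also have "\<dots> = (\<integral>\<omega>. ((a + b) / 2) ^ card (?R \<omega>) \<partial>\<mu>)"
  proof (rule Bochner_Integration.integral_cong[OF refl])
    fix \<omega>
    have "(\<integral>\<omega>'. ?f (mix K \<omega> \<omega>') \<partial>\<mu>) = (\<integral>\<omega>'. (\<Prod>h'\<in>?R \<omega>. ?g (\<omega>' h')) \<partial>\<mu>)"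
      unfolding R using inK by (intro Bochner_Integration.integral_cong prod.cong refl) (auto simp: mix_def)
    also have "\<dots> = ((a + b) / 2) ^ card (?R \<omega>)"
    proof (rule W.expectation_prod_coordinates[OF finite_returns])
      fix h' assume "h' \<in> ?R \<omega>"
      then obtain r where "h' = c # (k # c) # r" using returns_form by force
      then have "pmf (next_site d p h') (tl c) = 1 / 2" using pmf_return_up[OF k] by metis
      then show "measure_pmf.expectation (next_site d p h') ?g = (a + b) / 2"
        by (simp add: expectation_if_eq field_simps)
    qed (use a b in auto)
    finally show "(\<integral>\<omega>'. ?f (mix K \<omega> \<omega>') \<partial>\<mu>) = ((a + b) / 2) ^ card (?R \<omega>)" .
  qed
  also have "\<dots> \<le> \<phi> t ((a + b) / 2)" by (rule \<phi>_upper[OF \<eta>]) (use a b in auto)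
  finally show ?thesis .
qed

lemma prod_if_power:
  fixes x :: real
  assumes "finite R"
  shows "(\<Prod>h\<in>R. if P h then x else 1) = x ^ card {h \<in> R. P h}"
    "(\<Prod>h\<in>R. if P h then x else 0) = (if \<forall>h\<in>R. P h then x ^ card {h \<in> R. P h} else 0)"
proof -
  show "(\<Prod>h\<in>R. if P h then x else 1) = x ^ card {h \<in> R. P h}"
    using assms by (simp add: prod.If_cases Int_def)
  show "(\<Prod>h\<in>R. if P h then x else 0) = (if \<forall>h\<in>R. P h then x ^ card {h \<in> R. P h} else 0)"
  proof (cases "\<forall>h\<in>R. P h")
    case True
    then have "(\<Prod>h\<in>R. if P h then x else 0) = (\<Prod>h\<in>R. x)" "{h \<in> R. P h} = R" by auto
    then show ?thesis using True by simp
  next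
    case False
    then show ?thesis using assms by auto
  qed
qed

definition all_up :: "vertex \<Rightarrow> history \<Rightarrow> nat \<Rightarrow> (history \<Rightarrow> vertex) \<Rightarrow> bool" where
  "all_up c h t \<omega> \<longleftrightarrow> (\<forall>h'\<in>returns c h \<omega> t. \<omega> h' = tl (tl c))"

text \<open>
  The weights \<open>(x, 1)\<close> count the upward moves, and \<open>(x, 0)\<close> in addition forbid downward ones.
\<close>

lemma expectation_ups:
  assumes "entry_history (k # c) \<eta>" "k < d" "0 \<le> x" "x \<le> 1"
  shows "(\<integral>\<omega>. x ^ card (ups (k # c) \<eta> \<omega> t) \<partial>\<mu>) \<le> \<phi> t ((1 + x) / 2)"
    "(\<integral>\<omega>. (if all_up (k # c) \<eta> t \<omega> then x ^ card (ups (k # c) \<eta> \<omega> t) else 0) \<partial>\<mu>) \<le> \<phi> t (x / 2)"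
  unfolding ups_def all_up_def list.sel
  using expectation_returns_prod[OF assms(1,2), of x 1 t] expectation_returns_prod[OF assms(1,2), of x 0 t] assms(3,4)
  by (simp_all add: prod_if_power finite_returns add.commute[of x])

text \<open>
  What happens in a child \<open>k\<close> after its entry is independent of everything that does not involve its
  region, including the history \<open>\<epsilon>\<close> of the frog that enters it.  The factor \<open>g\<close> stands for the weight
  of the returns from the first child on an event on which \<open>k\<close> is entered, so that \<open>\<epsilon>\<close> has to be a possible
  entry only where \<open>g\<close> does not vanish.
\<close>

lemma fresh_child:
  assumes g: "finitely_determined g" "\<And>\<omega>. 0 \<le> g \<omega>" "\<And>\<omega>. g \<omega> \<le> (1 :: real)"
    and g_cong: "\<And>\<omega> \<omega>'. (\<And>h'. h' \<notin> region (k # c) \<Longrightarrow> \<omega> h' = \<omega>' h') \<Longrightarrow> g \<omega> = g \<omega>'"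
    and \<epsilon>: "finitely_determined \<epsilon>" "\<And>\<omega>. legal \<omega> \<Longrightarrow> g \<omega> \<noteq> 0 \<Longrightarrow> entry_history (k # c) (\<epsilon> \<omega>)"
    and \<epsilon>_cong: "\<And>\<omega> \<omega>'. legal \<omega> \<Longrightarrow> legal \<omega>' \<Longrightarrow> (\<And>h'. h' \<notin> region (k # c) \<Longrightarrow> \<omega> h' = \<omega>' h') \<Longrightarrow> \<epsilon> \<omega> = \<epsilon> \<omega>'"
    and k: "k < d" and x: "0 \<le> x" "x \<le> 1"
  shows "(\<integral>\<omega>. g \<omega> * x ^ card (ups (k # c) (\<epsilon> \<omega>) \<omega> t) \<partial>\<mu>) \<le> \<phi> t ((1 + x) / 2) * (\<integral>\<omega>. g \<omega> \<partial>\<mu>)"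
    and "finitely_determined (\<lambda>\<omega>. g \<omega> * x ^ card (ups (k # c) (\<epsilon> \<omega>) \<omega> t))"
proof -
  let ?K = "region (k # c)"
  let ?u = "\<lambda>\<eta> \<omega>. x ^ card (ups (k # c) \<eta> \<omega> t)"
  let ?f = "\<lambda>\<omega>. g \<omega> * ?u (\<epsilon> \<omega>) \<omega>"
  have "finitely_determined (\<lambda>\<omega>. ?u (\<epsilon> \<omega>) \<omega>)"
    by (rule finitely_determined_bind[OF \<epsilon>(1), of ?u]) (rule fd_ups_power)
  then show fd: "finitely_determined ?f" by (rule finitely_determined_comp2[OF g(1)])
  have bd: "\<bar>?f \<omega>\<bar> \<le> 1" for \<omega>
    using g(2,3) x by (simp add: abs_mult mult_le_one power_le_one)
  have "(\<integral>\<omega>. ?f \<omega> \<partial>\<mu>) = (\<integral>\<omega>. (\<integral>\<omega>'. ?f (mix ?K \<omega> \<omega>') \<partial>\<mu>) \<partial>\<mu>)"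
    by (rule W.expectation_mix(1)[OF fd bd])
  also have "\<dots> \<le> (\<integral>\<omega>. \<phi> t ((1 + x) / 2) * g \<omega> \<partial>\<mu>)"
  proof (rule integral_mono_AE)
    show "integrable \<mu> (\<lambda>\<omega>. \<integral>\<omega>'. ?f (mix ?K \<omega> \<omega>') \<partial>\<mu>)" by (rule W.expectation_mix(2)[OF fd bd])
    show "integrable \<mu> (\<lambda>\<omega>. \<phi> t ((1 + x) / 2) * g \<omega>)"
      using expectation_bounds(3)[OF g] by simp
    show "AE \<omega> in \<mu>. (\<integral>\<omega>'. ?f (mix ?K \<omega> \<omega>') \<partial>\<mu>) \<le> \<phi> t ((1 + x) / 2) * g \<omega>"
      using AE_legal
    proof eventually_elim
      case (elim \<omega>)
      have "(\<integral>\<omega>'. ?f (mix ?K \<omega> \<omega>') \<partial>\<mu>) = (\<integral>\<omega>'. g \<omega> * ?u (\<epsilon> \<omega>) \<omega>' \<partial>\<mu>)"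
      proof (rule integral_cong_AE)
        show "(\<lambda>\<omega>'. ?f (mix ?K \<omega> \<omega>')) \<in> borel_measurable \<mu>"
          by (rule W.measurable_finitely_determined_borel[OF finitely_determined_mix[OF fd]])
        show "(\<lambda>\<omega>'. g \<omega> * ?u (\<epsilon> \<omega>) \<omega>') \<in> borel_measurable \<mu>"
          by (rule W.measurable_finitely_determined_borel[OF finitely_determined_comp[OF fd_ups_power]])
        show "AE \<omega>' in \<mu>. ?f (mix ?K \<omega> \<omega>') = g \<omega> * ?u (\<epsilon> \<omega>) \<omega>'"
          using AE_legal
        proof eventually_elim
          case (elim \<omega>')
          have "g (mix ?K \<omega> \<omega>') = g \<omega>" by (rule g_cong) (simp add: mix_def)
          moreover have "\<epsilon> (mix ?K \<omega> \<omega>') = \<epsilon> \<omega>"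
            by (rule \<epsilon>_cong[OF legal_mix[OF \<open>legal \<omega>\<close> elim] \<open>legal \<omega>\<close>]) (simp add: mix_def)
          moreover have "ups (k # c) \<eta> (mix ?K \<omega> \<omega>') t = ups (k # c) \<eta> \<omega>' t" for \<eta>
            by (rule ups_cong) (simp add: mix_def)
          ultimately show ?case by simp
        qed
      qed
      also have "\<dots> = g \<omega> * (\<integral>\<omega>'. ?u (\<epsilon> \<omega>) \<omega>' \<partial>\<mu>)" by simp
      also have "\<dots> \<le> g \<omega> * \<phi> t ((1 + x) / 2)"
      proof (cases "g \<omega> = 0")
        case False
        then show ?thesis
          using expectation_ups(1)[OF \<epsilon>(2)[OF elim False] k x] g(2)[of \<omega>] by (intro mult_left_mono) auto
      qed simp
      finally show ?case by (simp add: mult.commute)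
    qed
  qed
  also have "\<dots> = \<phi> t ((1 + x) / 2) * (\<integral>\<omega>. g \<omega> \<partial>\<mu>)" by simp
  finally show "(\<integral>\<omega>. ?f \<omega> \<partial>\<mu>) \<le> \<phi> t ((1 + x) / 2) * (\<integral>\<omega>. g \<omega> \<partial>\<mu>)" .
qed

end

section \<open>The recursive inequality\<close>

context frog_tie
begin

lemma first_choices_outside_region:
  assumes "entry_history c h"
  shows "c # h \<notin> region (k # c)" "[c] \<notin> region (k # c)"
proof -
  have "hd h \<noteq> k # c"
  proof
    assume "hd h = k # c"
    then have "tl c = k # c" using entry_historyD(4)[OF assms] by simp
    then have "length (tl c) = Suc (length c)" by simp
    then show False by simp
  qed
  then show "c # h \<notin> region (k # c)" "[c] \<notin> region (k # c)"
    using child_notin_subtree unfolding region_def by auto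
qed

text \<open>
  The case that the frog of \<open>c\<close> does not open a second child.  Either all frogs returning from \<open>j\<close> go
  up, which is the term with \<open>x / 2\<close>, or one of them opens a further child, which contributes an
  independent factor.  The function \<open>F\<close> is the weight of the returns from \<open>c\<close>, without the
  factor for the frog of \<open>c\<close> if that frog moves up.
\<close>

lemma one_child_bound:
  assumes "entry_history (j # c) \<eta>" "j < d" "0 \<le> x" "x \<le> 1"
    and fin: "\<And>k \<omega>. k \<noteq> j \<Longrightarrow> k < d \<Longrightarrow> legal \<omega> \<Longrightarrow> k # c \<in> \<omega> ` returns (j # c) \<eta> \<omega> t \<Longrightarrow> entry_history (k # c) (\<epsilon> k \<omega>)"
    and fd: "\<And>k. finitely_determined (\<epsilon> k)"
    and \<epsilon>_cong: "\<And>k \<omega> \<omega>'. legal \<omega> \<Longrightarrow> legal \<omega>' \<Longrightarrow> (\<And>h'. h' \<notin> region (k # c) \<Longrightarrow> \<omega> h' = \<omega>' h') \<Longrightarrow> \<epsilon> k \<omega> = \<epsilon> k \<omega>'"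
    and F: "finitely_determined F" "\<And>\<omega>. \<bar>F \<omega>\<bar> \<le> (1 :: real)"
    and F_le: "\<And>\<omega>. legal \<omega> \<Longrightarrow> F \<omega> \<le> x ^ card (ups (j # c) \<eta> \<omega> t)"
    and F_le2: "\<And>k \<omega>. legal \<omega> \<Longrightarrow> k \<noteq> j \<Longrightarrow> k < d \<Longrightarrow> k # c \<in> \<omega> ` returns (j # c) \<eta> \<omega> t \<Longrightarrow>
        F \<omega> \<le> x ^ card (ups (j # c) \<eta> \<omega> t) * x ^ card (ups (k # c) (\<epsilon> k \<omega>) \<omega> t)"
  shows "(\<integral>\<omega>. F \<omega> \<partial>\<mu>) \<le> \<phi> t (x / 2) * (1 - \<phi> t ((1 + x) / 2)) + (\<phi> t ((1 + x) / 2))\<^sup>2"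
proof -
  let ?y = "\<phi> t ((1 + x) / 2)"
  let ?U = "\<lambda>\<omega>. x ^ card (ups (j # c) \<eta> \<omega> t)"
  let ?N = "\<lambda>\<omega>. if all_up (j # c) \<eta> t \<omega> then ?U \<omega> else 0"
  let ?D = "\<lambda>\<omega>. {k. k \<noteq> j \<and> k < d \<and> k # c \<in> \<omega> ` returns (j # c) \<eta> \<omega> t}"
  \<comment> \<open>One of the children other than \<open>j\<close> that are chosen by the returning frogs; the value \<open>j\<close> stands
    for none.  It has to be selected by the choices in the region of \<open>j\<close> alone, not by the entry
    times, to be unaffected by resampling the region of the selected child.\<close>
  define \<kappa> where "\<kappa> \<omega> = (if ?D \<omega> = {} then j else LEAST k. k \<in> ?D \<omega>)" for \<omega>
  let ?g = "\<lambda>k \<omega>. if \<kappa> \<omega> = k then ?U \<omega> else 0"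
  let ?K = "{k. k < d \<and> k \<noteq> j}"
  let ?h = "\<lambda>k \<omega>. ?g k \<omega> * x ^ card (ups (k # c) (\<epsilon> k \<omega>) \<omega> t)"
  have \<kappa>: "\<kappa> \<omega> \<in> ?D \<omega>" if "\<kappa> \<omega> \<noteq> j" for \<omega>
  proof -
    have "?D \<omega> \<noteq> {}"
    proof
      assume "?D \<omega> = {}"
      then have "\<kappa> \<omega> = j" unfolding \<kappa>_def by (rule if_P)
      then show False using that by blast
    qed
    moreover from this have "(LEAST k. k \<in> ?D \<omega>) \<in> ?D \<omega>" by (metis (no_types, lifting) LeastI_ex ex_in_conv)
    ultimately show ?thesis by (simp add: \<kappa>_def)
  qed
  have \<kappa>_fd: "finitely_determined \<kappa>"
  proof -
    have "finitely_determined (\<lambda>\<omega>. (\<lambda>R m. if {k. k \<noteq> j \<and> k < d \<and> k # c \<in> m ` R} = {} then j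
        else LEAST k. k \<in> {k. k \<noteq> j \<and> k < d \<and> k # c \<in> m ` R})
        (returns (j # c) \<eta> \<omega> t) (restrict \<omega> (returns (j # c) \<eta> \<omega> t)))"
      by (rule finitely_determined_comp2[OF finitely_determined_returns finitely_determined_moves])
    moreover have "restrict m R ` R = m ` R" for m :: "history \<Rightarrow> vertex" and R by auto
    ultimately show ?thesis by (simp only: \<kappa>_def[abs_def])
  qed
  have all_up_fd: "finitely_determined (all_up (j # c) \<eta> t)"
  proof -
    have "finitely_determined (\<lambda>\<omega>. (\<lambda>R m. \<forall>h'\<in>R. m h' = tl (tl (j # c)))
        (returns (j # c) \<eta> \<omega> t) (restrict \<omega> (returns (j # c) \<eta> \<omega> t)))"
      by (rule finitely_determined_comp2[OF finitely_determined_returns finitely_determined_moves])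
    then show ?thesis by (simp add: all_up_def[abs_def])
  qed
  have U01: "0 \<le> ?U \<omega>" "?U \<omega> \<le> 1" for \<omega> using assms(3,4) by (auto simp: power_le_one)
  have y01: "0 \<le> ?y" "?y \<le> 1" using \<phi>_bounds[of "(1 + x) / 2" t] assms(3,4) by auto
  have g_fd: "finitely_determined (?g k)" for k
    by (rule finitely_determined_comp2[OF \<kappa>_fd fd_ups_power, of "\<lambda>a u. if a = k then u else 0"])
  have N_fd: "finitely_determined ?N"
    by (rule finitely_determined_comp2[OF all_up_fd fd_ups_power, of "\<lambda>a u. if a then u else 0"])
  note U_int = expectation_bounds(3)[OF fd_ups_power U01]
  have N_int: "integrable \<mu> ?N"
    by (rule expectation_bounds(3)[OF N_fd]) (use U01 in auto)
  have g_int: "integrable \<mu> (?g k)" for k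
    by (rule expectation_bounds(3)[OF g_fd]) (use U01 in auto)
  have fresh: "(\<integral>\<omega>. ?h k \<omega> \<partial>\<mu>) \<le> ?y * (\<integral>\<omega>. ?g k \<omega> \<partial>\<mu>)" "finitely_determined (?h k)" if k: "k \<in> ?K" for k
  proof -
    have cong: "?g k \<omega> = ?g k \<omega>'" if eq: "\<And>h'. h' \<notin> region (k # c) \<Longrightarrow> \<omega> h' = \<omega>' h'" for \<omega> \<omega>'
    proof -
      have "\<omega> h' = \<omega>' h'" if "h' \<in> region (j # c)" for h'
        using that eq region_siblings[of j k c] k by blast
      then have same: "ups (j # c) \<eta> \<omega> t = ups (j # c) \<eta> \<omega>' t"
        "\<omega> ` returns (j # c) \<eta> \<omega> t = \<omega>' ` returns (j # c) \<eta> \<omega>' t"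
        by (intro ups_cong; blast)+
      show ?thesis unfolding \<kappa>_def same ..
    qed
    have adm: "entry_history (k # c) (\<epsilon> k \<omega>)" if "legal \<omega>" "?g k \<omega> \<noteq> 0" for \<omega>
    proof -
      have "\<kappa> \<omega> = k" using that by (auto split: if_splits)
      then show ?thesis using \<kappa>[of \<omega>] k fin[of k \<omega>] that by auto
    qed
    show "(\<integral>\<omega>. ?h k \<omega> \<partial>\<mu>) \<le> ?y * (\<integral>\<omega>. ?g k \<omega> \<partial>\<mu>)" "finitely_determined (?h k)"
      by (rule fresh_child[OF g_fd _ _ cong fd adm \<epsilon>_cong]; use U01 k assms(3,4) in auto)+
  qed
  have h_int: "integrable \<mu> (?h k)" if "k \<in> ?K" for k
    by (rule expectation_bounds(3)[OF fresh(2)[OF that]]) (use U01 assms(3,4) in \<open>auto simp: mult_le_one power_le_one\<close>)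
  have point: "F \<omega> \<le> ?N \<omega> + (\<Sum>k\<in>?K. ?h k \<omega>)" if leg: "legal \<omega>" for \<omega>
  proof (cases "all_up (j # c) \<eta> t \<omega>")
    case True
    have "0 \<le> (\<Sum>k\<in>?K. ?h k \<omega>)" using U01 assms(3) by (intro sum_nonneg) auto
    then show ?thesis using F_le[OF leg] True by simp
  next
    case False
    then obtain h' where h': "h' \<in> returns (j # c) \<eta> \<omega> t" "\<omega> h' \<noteq> tl c" unfolding all_up_def by auto
    obtain r where r: "h' = c # (j # c) # r" using returns_form[OF h'(1)] by auto
    have "\<omega> h' \<in> children d c"
      using legal_to_neighbours[OF leg] h'(2) unfolding to_neighbours_def r by (metis list.distinct(1) list.sel(1))
    then obtain k where k: "\<omega> h' = k # c" "k < d" by (auto simp: children_iff)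
    moreover have "k \<noteq> j" using legal_return[OF leg assms(2), of c r] k r by auto
    ultimately have "k \<in> ?D \<omega>" using h'(1) by (auto intro: image_eqI[of _ _ h'])
    then have "?D \<omega> \<noteq> {}" by blast
    moreover from this have "(LEAST k. k \<in> ?D \<omega>) \<in> ?D \<omega>" by (metis (no_types, lifting) LeastI_ex ex_in_conv)
    ultimately have kk: "\<kappa> \<omega> \<in> ?D \<omega>" by (simp add: \<kappa>_def)
    then have "F \<omega> \<le> ?h (\<kappa> \<omega>) \<omega>" using F_le2[OF leg, of "\<kappa> \<omega>"] by simp
    also have "\<dots> \<le> (\<Sum>k\<in>?K. ?h k \<omega>)"
      by (rule member_le_sum) (use kk U01 assms(3) in auto)
    finally show ?thesis using False by simp
  qed
  have "(\<integral>\<omega>. (\<Sum>k\<in>?K. ?g k \<omega>) \<partial>\<mu>) \<le> (\<integral>\<omega>. ?U \<omega> - ?N \<omega> \<partial>\<mu>)"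
  proof (rule integral_mono)
    show "integrable \<mu> (\<lambda>\<omega>. \<Sum>k\<in>?K. ?g k \<omega>)" by (intro Bochner_Integration.integrable_sum g_int)
    show "integrable \<mu> (\<lambda>\<omega>. ?U \<omega> - ?N \<omega>)" by (intro Bochner_Integration.integrable_diff U_int N_int)
    fix \<omega>
    have s: "(\<Sum>k\<in>?K. ?g k \<omega>) = (if \<kappa> \<omega> \<in> ?K then ?U \<omega> else 0)"
      by (subst sum.delta') auto
    show "(\<Sum>k\<in>?K. ?g k \<omega>) \<le> ?U \<omega> - ?N \<omega>"
    proof (cases "all_up (j # c) \<eta> t \<omega>")
      case True
      have "k # c \<notin> \<omega> ` returns (j # c) \<eta> \<omega> t" for k
        using True parent_notin_children[of c "Suc k"] unfolding all_up_def children_iff by auto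
      then have "\<kappa> \<omega> = j" by (simp add: \<kappa>_def)
      then show ?thesis using s True by simp
    qed (use s U01 in simp)
  qed
  then have sum_g: "(\<integral>\<omega>. (\<Sum>k\<in>?K. ?g k \<omega>) \<partial>\<mu>) \<le> (\<integral>\<omega>. ?U \<omega> \<partial>\<mu>) - (\<integral>\<omega>. ?N \<omega> \<partial>\<mu>)"
    unfolding Bochner_Integration.integral_diff[OF U_int N_int] .
  have "(\<integral>\<omega>. F \<omega> \<partial>\<mu>) \<le> (\<integral>\<omega>. ?N \<omega> + (\<Sum>k\<in>?K. ?h k \<omega>) \<partial>\<mu>)"
  proof (rule integral_mono_AE)
    show "integrable \<mu> F" by (rule W.integrable_finitely_determined[OF F])
    show "integrable \<mu> (\<lambda>\<omega>. ?N \<omega> + (\<Sum>k\<in>?K. ?h k \<omega>))"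
      by (intro Bochner_Integration.integrable_add N_int Bochner_Integration.integrable_sum h_int)
    show "AE \<omega> in \<mu>. F \<omega> \<le> ?N \<omega> + (\<Sum>k\<in>?K. ?h k \<omega>)"
      using AE_legal by eventually_elim (rule point)
  qed
  also have "\<dots> = (\<integral>\<omega>. ?N \<omega> \<partial>\<mu>) + (\<Sum>k\<in>?K. \<integral>\<omega>. ?h k \<omega> \<partial>\<mu>)"
    using h_int by (subst Bochner_Integration.integral_add[OF N_int]) (auto simp: Bochner_Integration.integral_sum)
  also have "\<dots> \<le> (\<integral>\<omega>. ?N \<omega> \<partial>\<mu>) + (\<Sum>k\<in>?K. ?y * (\<integral>\<omega>. ?g k \<omega> \<partial>\<mu>))"
    by (intro add_left_mono sum_mono fresh(1))
  also have "(\<Sum>k\<in>?K. ?y * (\<integral>\<omega>. ?g k \<omega> \<partial>\<mu>)) = ?y * (\<integral>\<omega>. (\<Sum>k\<in>?K. ?g k \<omega>) \<partial>\<mu>)"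
    using g_int by (subst Bochner_Integration.integral_sum) (auto simp: sum_distrib_left)
  also have "(\<integral>\<omega>. ?N \<omega> \<partial>\<mu>) + ?y * (\<integral>\<omega>. (\<Sum>k\<in>?K. ?g k \<omega>) \<partial>\<mu>)
      \<le> (\<integral>\<omega>. ?N \<omega> \<partial>\<mu>) + ?y * ((\<integral>\<omega>. ?U \<omega> \<partial>\<mu>) - (\<integral>\<omega>. ?N \<omega> \<partial>\<mu>))"
    by (intro add_left_mono mult_left_mono sum_g y01)
  also have "(\<integral>\<omega>. ?N \<omega> \<partial>\<mu>) + ?y * ((\<integral>\<omega>. ?U \<omega> \<partial>\<mu>) - (\<integral>\<omega>. ?N \<omega> \<partial>\<mu>))
      = (\<integral>\<omega>. ?N \<omega> \<partial>\<mu>) * (1 - ?y) + ?y * (\<integral>\<omega>. ?U \<omega> \<partial>\<mu>)"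
    by (simp add: algebra_simps)
  also have "\<dots> \<le> \<phi> t (x / 2) * (1 - ?y) + ?y * ?y"
    using expectation_ups[OF assms(1-4), of t] y01 by (intro add_mono mult_right_mono mult_left_mono) auto
  finally show ?thesis by (simp add: power2_eq_square)
qed

text \<open>
  The case that the frog of \<open>c\<close> opens a second child \<open>k\<close>: then two independent subtrees contribute
  for certain.
\<close>

lemma two_child_bound:
  assumes "entry_history (j # c) \<eta>" "j < d" "k < d" "k \<noteq> j" "0 \<le> x" "x \<le> 1"
    and \<epsilon>: "finitely_determined \<epsilon>" "\<And>\<omega>. legal \<omega> \<Longrightarrow> entry_history (k # c) (\<epsilon> \<omega>)"
    and \<epsilon>_cong: "\<And>\<omega> \<omega>'. legal \<omega> \<Longrightarrow> legal \<omega>' \<Longrightarrow> (\<And>h'. h' \<notin> region (k # c) \<Longrightarrow> \<omega> h' = \<omega>' h') \<Longrightarrow> \<epsilon> \<omega> = \<epsilon> \<omega>'"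
    and F: "finitely_determined F" "\<And>\<omega>. \<bar>F \<omega>\<bar> \<le> (1 :: real)"
    and F_le: "\<And>\<omega>. legal \<omega> \<Longrightarrow>
        F \<omega> \<le> x ^ card (ups (j # c) \<eta> \<omega> t) * x ^ card (ups (k # c) (\<epsilon> \<omega>) \<omega> t)"
  shows "(\<integral>\<omega>. F \<omega> \<partial>\<mu>) \<le> (\<phi> t ((1 + x) / 2))\<^sup>2"
proof -
  let ?y = "\<phi> t ((1 + x) / 2)"
  let ?U = "\<lambda>\<omega>. x ^ card (ups (j # c) \<eta> \<omega> t)"
  let ?h = "\<lambda>\<omega>. ?U \<omega> * x ^ card (ups (k # c) (\<epsilon> \<omega>) \<omega> t)"
  have U01: "0 \<le> ?U \<omega>" "?U \<omega> \<le> 1" for \<omega> using assms(5,6) by (auto simp: power_le_one)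
  have y01: "0 \<le> ?y" "?y \<le> 1" using \<phi>_bounds[of "(1 + x) / 2" t] assms(5,6) by auto
  have cong: "?U \<omega> = ?U \<omega>'" if eq: "\<And>h'. h' \<notin> region (k # c) \<Longrightarrow> \<omega> h' = \<omega>' h'" for \<omega> \<omega>'
  proof -
    have "\<omega> h' = \<omega>' h'" if "h' \<in> region (j # c)" for h'
      using that eq region_siblings[of j k c] assms(4) by blast
    then show ?thesis using ups_cong(2)[of "j # c" \<omega> \<omega>'] by metis
  qed
  have fresh: "(\<integral>\<omega>. ?h \<omega> \<partial>\<mu>) \<le> ?y * (\<integral>\<omega>. ?U \<omega> \<partial>\<mu>)" "finitely_determined ?h"
    by (rule fresh_child[OF fd_ups_power U01 cong \<epsilon> \<epsilon>_cong assms(3,5,6)]; assumption)+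
  have "(\<integral>\<omega>. F \<omega> \<partial>\<mu>) \<le> (\<integral>\<omega>. ?h \<omega> \<partial>\<mu>)"
  proof (rule integral_mono_AE)
    show "integrable \<mu> F" by (rule W.integrable_finitely_determined[OF F])
    show "integrable \<mu> ?h"
      by (rule expectation_bounds(3)[OF fresh(2)]) (use U01 assms(5,6) in \<open>auto simp: mult_le_one power_le_one\<close>)
    show "AE \<omega> in \<mu>. F \<omega> \<le> ?h \<omega>" using AE_legal by eventually_elim (rule F_le)
  qed
  also note fresh(1)
  also have "?y * (\<integral>\<omega>. ?U \<omega> \<partial>\<mu>) \<le> ?y * ?y"
    using expectation_ups(1)[OF assms(1,2,5,6)] y01 by (intro mult_left_mono) auto
  finally show ?thesis by (simp add: power2_eq_square)
qed

text \<open>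
  First all choices but those of the frog that enters \<open>c\<close> and of the frog of \<open>c\<close> are averaged, with
  one of the two preceding bounds in each case, and then the average over the frog of \<open>c\<close> is taken.
  That frog goes up with probability \<open>p\<close>, follows the other frog to \<open>j\<close> with probability \<open>(1 - p) / d\<close>,
  and opens another child with the remaining probability, which is again \<open>p\<close>.
\<close>

theorem \<phi>_recursion:
  assumes x: "0 \<le> x" "x \<le> 1"
  defines "y \<equiv> (1 + x) / 2"
  shows "\<phi> (2 * t + 3) x \<le>
    (p * x + (1 - p) / d) * (\<phi> t (x / 2) * (1 - \<phi> t y) + (\<phi> t y)\<^sup>2) + p * (\<phi> t y)\<^sup>2"
proof (rule \<phi>_least)
  fix c h assume h: "entry_history c h"
  have c: "c \<noteq> []" using entry_historyD[OF h] by simp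
  let ?F = "\<lambda>\<omega>. x ^ card (returns c h \<omega> (2 * t + 3))"
  define b where "b = \<phi> t (x / 2) * (1 - \<phi> t y) + (\<phi> t y)\<^sup>2"
  \<comment> \<open>The bound as a function of the first moves \<open>a\<close> of the entering frog and \<open>v\<close> of the frog of \<open>c\<close>.\<close>
  define w where "w a v = (if v = tl c then x * b else if v = a then b else (\<phi> t y)\<^sup>2)" for a v :: vertex
  define K where "K = - {c # h, [c]}"
  have y: "0 \<le> y" "y \<le> 1" "0 \<le> x / 2" "x / 2 \<le> 1" using x by (auto simp: y_def)
  note y01 = \<phi>_bounds[OF y(1,2), of t] \<phi>_bounds[OF y(3,4), of t]
  have F_bd: "\<bar>?F \<omega>\<bar> \<le> 1" for \<omega> using x by (simp add: power_le_one)
  have inner: "(\<integral>\<omega>'. ?F (mix K \<omega> \<omega>') \<partial>\<mu>) \<le> w (\<omega> (c # h)) (\<omega> [c])" if leg: "legal \<omega>" for \<omega>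
  proof -
    obtain j where j: "\<omega> (c # h) = j # c" "j < d"
      using legal_downward[OF leg h] by (auto simp: children_iff)
    define \<eta> where "\<eta> = entrant c h j 0 \<omega>"
    define \<epsilon> where "\<epsilon> k \<omega>' = entrant c h k (t + 1) (mix K \<omega> \<omega>')" for k \<omega>'
    have mc: "mix K \<omega> \<omega>' (c # h) = \<omega> (c # h)" "mix K \<omega> \<omega>' [c] = \<omega> [c]" for \<omega>'
      by (simp_all add: mix_def K_def)
    have \<eta>': "\<eta> = entrant c h j 0 (mix K \<omega> \<omega>')" for \<omega>'
      unfolding \<eta>_def by (rule entrant_cong_first_step) (simp_all add: mc)
    have nb: "to_neighbours d (mix K \<omega> \<omega>')" if "legal \<omega>'" for \<omega>'
      by (rule legal_to_neighbours[OF legal_mix[OF leg that]])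
    have reg: "mix K \<omega> \<omega>' h' = \<omega>' h'" if "h' \<in> region (k # c)" for h' k \<omega>'
      using that first_choices_outside_region[OF h] by (auto simp: mix_def K_def)
    have ups: "ups (k # c) \<zeta> (mix K \<omega> \<omega>') t = ups (k # c) \<zeta> \<omega>' t"
      "mix K \<omega> \<omega>' ` returns (k # c) \<zeta> (mix K \<omega> \<omega>') t = \<omega>' ` returns (k # c) \<zeta> \<omega>' t" for k \<zeta> \<omega>'
      by (rule ups_cong, rule reg, assumption)+
    have adm: "entry_history (j # c) \<eta>"
      using card_returns_ge(1)[OF h legal_to_neighbours[OF leg] j \<eta>_def] .
    let ?s = "if \<omega> [c] = tl c then 1 else 0 :: nat"
    have card1: "?s + card (ups (j # c) \<eta> \<omega>' t) \<le> card (returns c h (mix K \<omega> \<omega>') (2 * t + 3))" if "legal \<omega>'" for \<omega>'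
      using card_returns_ge(2)[OF h nb[OF that] _ j(2) \<eta>', of t] j(1) unfolding mc ups by simp
    have card2: "entry_history (k # c) (\<epsilon> k \<omega>') \<and>
        ?s + card (ups (j # c) \<eta> \<omega>' t) + card (ups (k # c) (\<epsilon> k \<omega>') \<omega>' t) \<le> card (returns c h (mix K \<omega> \<omega>') (2 * t + 3))"
      if "legal \<omega>'" "k \<noteq> j" "k < d" "\<omega> [c] = k # c \<or> k # c \<in> \<omega>' ` returns (j # c) \<eta> \<omega>' t" for k \<omega>'
      using card_returns_ge(3)[OF h nb[OF that(1)] _ j(2) \<eta>' that(2,3) _ refl, of t] j(1) that(4)
      unfolding mc ups \<epsilon>_def by simp
    have pw: "x ^ m \<le> x ^ n" if "n \<le> m" for m n using that x by (rule power_decreasing)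
    have \<epsilon>_fd: "finitely_determined (\<epsilon> k)" for k
      unfolding \<epsilon>_def[abs_def] by (rule finitely_determined_mix[OF finitely_determined_entrant])
    have \<epsilon>_cong: "\<epsilon> k \<omega>' = \<epsilon> k \<omega>''" if "legal \<omega>'" "legal \<omega>''" "\<And>h'. h' \<notin> region (k # c) \<Longrightarrow> \<omega>' h' = \<omega>'' h'" for k \<omega>' \<omega>''
      unfolding \<epsilon>_def by (rule entrant_cong_outside_region[OF h nb nb]) (use that in \<open>auto simp: mix_def\<close>)
    have F_fd: "finitely_determined (\<lambda>\<omega>'. ?F (mix K \<omega> \<omega>'))"
      by (rule finitely_determined_mix[OF fd_returns_power])
    consider (up) "\<omega> [c] = tl c" | (same) "\<omega> [c] = j # c" | (other) k where "\<omega> [c] = k # c" "k < d" "k \<noteq> j"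
      using legal_to_neighbours[OF leg] unfolding to_neighbours_def children_iff by (metis list.distinct(1) list.sel(1))
    then show ?thesis
    proof cases
      case up
      let ?G = "\<lambda>\<omega>'. x ^ (card (returns c h (mix K \<omega> \<omega>') (2 * t + 3)) - 1)"
      have G_fd: "finitely_determined ?G"
        using finitely_determined_mix[OF finitely_determined_comp[OF finitely_determined_returns, of "\<lambda>R. x ^ (card R - 1)"]] .
      have G_bd: "\<bar>?G \<omega>'\<bar> \<le> 1" for \<omega>' using x by (simp add: power_le_one)
      have G: "(\<integral>\<omega>'. ?G \<omega>' \<partial>\<mu>) \<le> b"
        unfolding b_def y_def
      proof (rule one_child_bound[OF adm j(2) x _ \<epsilon>_fd \<epsilon>_cong G_fd G_bd])
        show "?G \<omega>' \<le> x ^ card (ups (j # c) \<eta> \<omega>' t)" if "legal \<omega>'" for \<omega>'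
          using card1[OF that] up by (intro pw) simp
        show "?G \<omega>' \<le> x ^ card (ups (j # c) \<eta> \<omega>' t) * x ^ card (ups (k # c) (\<epsilon> k \<omega>') \<omega>' t)"
          if "legal \<omega>'" "k \<noteq> j" "k < d" "k # c \<in> \<omega>' ` returns (j # c) \<eta> \<omega>' t" for k \<omega>'
          using conjunct2[OF card2[OF that(1-3) disjI2[OF that(4)]]] up
          unfolding power_add[symmetric] by (intro pw) simp
      qed (use card2 in blast)+
      have "(\<integral>\<omega>'. ?F (mix K \<omega> \<omega>') \<partial>\<mu>) \<le> (\<integral>\<omega>'. x * ?G \<omega>' \<partial>\<mu>)"
      proof (rule integral_mono_AE)
        show "integrable \<mu> (\<lambda>\<omega>'. ?F (mix K \<omega> \<omega>'))" by (rule W.integrable_finitely_determined[OF F_fd F_bd])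
        show "integrable \<mu> (\<lambda>\<omega>'. x * ?G \<omega>')"
          using W.integrable_finitely_determined[OF G_fd G_bd] by simp
        show "AE \<omega>' in \<mu>. ?F (mix K \<omega> \<omega>') \<le> x * ?G \<omega>'"
          using AE_legal
        proof eventually_elim
          case (elim \<omega>')
          then have "0 < card (returns c h (mix K \<omega> \<omega>') (2 * t + 3))" using card1[OF elim] up by simp
          then show ?case by (cases "card (returns c h (mix K \<omega> \<omega>') (2 * t + 3))") auto
        qed
      qed
      also have "\<dots> \<le> x * b" using G x by (simp add: mult_left_mono)
      finally show ?thesis using up by (simp add: w_def)
    next
      case same
      have "j # c \<noteq> tl c" using parent_notin_children[of c d] j(2) children_iff[of "j # c" d c] by metis
      then have s: "\<omega> [c] \<noteq> tl c" using same by simp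
      have "(\<integral>\<omega>'. ?F (mix K \<omega> \<omega>') \<partial>\<mu>) \<le> b"
        unfolding b_def y_def
      proof (rule one_child_bound[OF adm j(2) x _ \<epsilon>_fd \<epsilon>_cong F_fd F_bd])
        show "?F (mix K \<omega> \<omega>') \<le> x ^ card (ups (j # c) \<eta> \<omega>' t)" if "legal \<omega>'" for \<omega>'
          using card1[OF that] by (intro pw) simp
        show "?F (mix K \<omega> \<omega>') \<le> x ^ card (ups (j # c) \<eta> \<omega>' t) * x ^ card (ups (k # c) (\<epsilon> k \<omega>') \<omega>' t)"
          if "legal \<omega>'" "k \<noteq> j" "k < d" "k # c \<in> \<omega>' ` returns (j # c) \<eta> \<omega>' t" for k \<omega>'
          using card2[OF that(1-3) disjI2[OF that(4)]] unfolding power_add[symmetric] by (intro pw) simp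
      qed (use card2 in blast)+
      then show ?thesis using s same j by (simp add: w_def)
    next
      case (other k)
      have "k # c \<noteq> tl c" using parent_notin_children[of c d] other(2) children_iff[of "k # c" d c] by metis
      then have s: "\<omega> [c] \<noteq> tl c" "\<omega> [c] \<noteq> \<omega> (c # h)" using other j by simp_all
      have "(\<integral>\<omega>'. ?F (mix K \<omega> \<omega>') \<partial>\<mu>) \<le> (\<phi> t y)\<^sup>2"
        unfolding y_def
      proof (rule two_child_bound[OF adm j(2) other(2,3) x \<epsilon>_fd _ \<epsilon>_cong F_fd F_bd])
        show "?F (mix K \<omega> \<omega>') \<le> x ^ card (ups (j # c) \<eta> \<omega>' t) * x ^ card (ups (k # c) (\<epsilon> k \<omega>') \<omega>' t)"
          if "legal \<omega>'" for \<omega>'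
          using card2[OF that other(3,2) disjI1[OF other(1)]] unfolding power_add[symmetric] by (intro pw) simp
      qed (use card2 other in blast)+
      then show ?thesis using s by (simp add: w_def)
    qed
  qed
  have b01: "0 \<le> b" using y01 by (simp add: b_def)
  have w_fd: "finitely_determined (\<lambda>\<omega>. w (\<omega> (c # h)) (\<omega> [c]))"
    by (rule finitely_determined_comp2; rule finitely_determined_coordinate)
  have w_bd: "\<bar>w a v\<bar> \<le> \<bar>x * b\<bar> + \<bar>b\<bar> + (\<phi> t y)\<^sup>2" for a v by (simp add: w_def)
  have w_int: "integrable \<mu> (\<lambda>\<omega>. w (\<omega> (c # h)) (\<omega> [c]))"
    by (rule W.integrable_finitely_determined[OF w_fd w_bd])
  have "(\<integral>\<omega>. ?F \<omega> \<partial>\<mu>) = (\<integral>\<omega>. (\<integral>\<omega>'. ?F (mix K \<omega> \<omega>') \<partial>\<mu>) \<partial>\<mu>)"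
    by (rule W.expectation_mix(1)[OF fd_returns_power F_bd])
  also have "\<dots> \<le> (\<integral>\<omega>. w (\<omega> (c # h)) (\<omega> [c]) \<partial>\<mu>)"
  proof (rule integral_mono_AE)
    show "integrable \<mu> (\<lambda>\<omega>. \<integral>\<omega>'. ?F (mix K \<omega> \<omega>') \<partial>\<mu>)"
      by (rule W.expectation_mix(2)[OF fd_returns_power F_bd])
    show "AE \<omega> in \<mu>. (\<integral>\<omega>'. ?F (mix K \<omega> \<omega>') \<partial>\<mu>) \<le> w (\<omega> (c # h)) (\<omega> [c])"
      using AE_legal by eventually_elim (rule inner)
  qed (rule w_int)
  also have "\<dots> = (\<integral>\<omega>. (\<integral>\<omega>'. w (mix {[c]} \<omega> \<omega>' (c # h)) (mix {[c]} \<omega> \<omega>' [c]) \<partial>\<mu>) \<partial>\<mu>)"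
    by (rule W.expectation_mix(1)[OF w_fd w_bd])
  also have "\<dots> \<le> (\<integral>\<omega>. (p * x + (1 - p) / d) * b + p * (\<phi> t y)\<^sup>2 \<partial>\<mu>)"
  proof (rule integral_mono_AE)
    show "integrable \<mu> (\<lambda>\<omega>. \<integral>\<omega>'. w (mix {[c]} \<omega> \<omega>' (c # h)) (mix {[c]} \<omega> \<omega>' [c]) \<partial>\<mu>)"
      by (rule W.expectation_mix(2)[OF w_fd w_bd])
    show "AE \<omega> in \<mu>. (\<integral>\<omega>'. w (mix {[c]} \<omega> \<omega>' (c # h)) (mix {[c]} \<omega> \<omega>' [c]) \<partial>\<mu>) \<le>
        (p * x + (1 - p) / d) * b + p * (\<phi> t y)\<^sup>2"
      using AE_legal
    proof eventually_elim
      case (elim \<omega>)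
      let ?a = "\<omega> (c # h)" and ?q = "next_site d p [c]" and ?z = "(\<phi> t y)\<^sup>2"
      have a: "?a \<in> children d c" by (rule legal_downward[OF elim h])
      then have ne: "?a \<noteq> tl c" using parent_notin_children by metis
      have "(\<integral>\<omega>'. w (mix {[c]} \<omega> \<omega>' (c # h)) (mix {[c]} \<omega> \<omega>' [c]) \<partial>\<mu>) = (\<integral>\<omega>'. w ?a (\<omega>' [c]) \<partial>\<mu>)"
        using entry_historyD(2)[OF h] by (simp add: mix_def)
      also have "\<dots> = measure_pmf.expectation ?q (w ?a)" by (rule W.expectation_coordinate)
      also have "\<dots> = measure_pmf.expectation ?q
          (\<lambda>v. ((if v = tl c then x * b - ?z else 0) + (if v = ?a then b - ?z else 0)) + ?z)"
        using ne by (intro Bochner_Integration.integral_cong) (auto simp: w_def)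
      also have "\<dots> = (x * b - ?z) * p + (b - ?z) * ((1 - p) / d) + ?z"
      proof -
        have i: "integrable ?q (\<lambda>v. if v = u then r else (0 :: real))" for u :: vertex and r
          by (rule measure_pmf.integrable_const_bound[where B="\<bar>r\<bar>"]) auto
        show ?thesis
          using i by (simp add: expectation_if_eq pmf_wake_up[OF c] pmf_wake_down[OF c a] del: next_site.simps)
      qed
      also have "\<dots> = (p * x + (1 - p) / d) * b + (1 - (p + (1 - p) / d)) * ?z"
        by (simp add: algebra_simps)
      also have "\<dots> = (p * x + (1 - p) / d) * b + p * ?z"
        unfolding p_bounds(4) by simp
      finally show ?case by simp
    qed
  qed simp
  also have "\<dots> = (p * x + (1 - p) / d) * b + p * (\<phi> t y)\<^sup>2" by simp
  finally show "(\<integral>\<omega>. ?F \<omega> \<partial>\<mu>) \<le> (p * x + (1 - p) / d) *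
      (\<phi> t (x / 2) * (1 - \<phi> t y) + (\<phi> t y)\<^sup>2) + p * (\<phi> t y)\<^sup>2" by (simp add: b_def)
qed

end

section \<open>Vanishing of the generating function and recurrence\<close>

text \<open>
  The function \<open>(exp u - 1 - u) / u^2\<close> is increasing.  The proof differentiates the difference of the two
  sides in \<open>b\<close>; the derivative is nonnegative by convexity of the exponential function.
\<close>

lemma exp_remainder_scaling:
  fixes b s :: real
  assumes "0 \<le> b" "0 \<le> s" "s \<le> 1"
  shows "exp (b * s) - 1 - b * s \<le> s\<^sup>2 * (exp b - 1 - b)"
proof -
  define \<psi> where "\<psi> z = s\<^sup>2 * (exp z - 1 - z) - (exp (z * s) - 1 - z * s)" for z
  have "\<psi> 0 \<le> \<psi> b"
  proof (rule DERIV_nonneg_imp_nondecreasing[OF assms(1)])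
    fix z :: real
    have "(\<psi> has_real_derivative s * (s * (exp z - 1) - (exp (z * s) - 1))) (at z)"
      unfolding \<psi>_def by (auto intro!: derivative_eq_intros simp: algebra_simps power2_eq_square)
    moreover have "exp ((1 - s) * 0 + s * z) \<le> (1 - s) * exp 0 + s * exp z"
      using convex_onD[OF exp_convex, of s 0 z] assms by simp
    then have "0 \<le> s * (s * (exp z - 1) - (exp (z * s) - 1))"
      using assms(2) by (intro mult_nonneg_nonneg) (auto simp: algebra_simps)
    ultimately show "\<exists>y. (\<psi> has_real_derivative y) (at z) \<and> 0 \<le> y" by blast
  qed
  then show ?thesis by (simp add: \<psi>_def)
qed

text \<open>
  For \<open>s = 1\<close> the left-hand side is \<open>exp b - 1\<close>; the point is that the gain of a constant persists for
  all \<open>s\<close>, although the factor \<open>2 - s\<close> grows as \<open>s\<close> decreases.  By the scaling of the remainder it reduces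
  to \<open>u \<le> 1/2 + u^2 / 2\<close> for \<open>u = (1 - s) b\<close>.
\<close>

lemma exp_improvement:
  fixes b s :: real
  assumes "0 \<le> b" "0 \<le> s" "s \<le> 1"
  shows "(2 - s) * (exp (b * s) - 1) \<le> s * (exp b - 1 / 2)"
proof -
  define e where "e = exp b - 1 - b"
  have e: "b\<^sup>2 / 2 \<le> e" using exp_lower_Taylor_quadratic[OF assms(1)] by (simp add: e_def)
  define u where "u = (1 - s) * b"
  have "0 \<le> (1 - u)\<^sup>2" by simp
  then have "u \<le> 1 / 2 + u\<^sup>2 / 2" by (simp add: power2_eq_square algebra_simps)
  also have "u\<^sup>2 / 2 = (1 - s)\<^sup>2 * (b\<^sup>2 / 2)" by (simp add: u_def power_mult_distrib)
  also have "\<dots> \<le> (1 - s)\<^sup>2 * e" by (intro mult_left_mono e) simp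
  finally have key: "(1 - s) * b \<le> 1 / 2 + (1 - s)\<^sup>2 * e" by (simp add: u_def)
  have "(2 - s) * (exp (b * s) - 1) \<le> (2 - s) * (b * s + s\<^sup>2 * e)"
    using exp_remainder_scaling[OF assms] assms by (intro mult_left_mono) (auto simp: e_def)
  also have "\<dots> = s * ((1 - s) * b + b + e - (1 - s)\<^sup>2 * e)"
    by (simp add: power2_eq_square algebra_simps)
  also have "\<dots> \<le> s * (exp b - 1 / 2)"
    using key assms by (intro mult_left_mono) (auto simp: e_def)
  finally show ?thesis .
qed

text \<open>
  The recursion is monotone in \<open>f\<close>, so \<open>f\<close> may be replaced on the right by the exponential bound.
  Since \<open>f y\<close> appears squared and \<open>y - 1 = (x - 1) / 2\<close>, the bound reproduces itself up to a factor,
  and this factor is at most \<open>1 - (1 - x) exp (- a / 2) / 6\<close>.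
\<close>

lemma exp_bound_improves:
  fixes f :: "real \<Rightarrow> real"
  assumes f01: "\<And>x. 0 \<le> x \<Longrightarrow> x \<le> 1 \<Longrightarrow> 0 \<le> f x \<and> f x \<le> 1"
    and mono: "\<And>x y. 0 \<le> x \<Longrightarrow> x \<le> y \<Longrightarrow> y \<le> 1 \<Longrightarrow> f x \<le> f y"
    and rec: "\<And>x. 0 \<le> x \<Longrightarrow> x \<le> 1 \<Longrightarrow>
      f x \<le> (x + 2) / 3 * (f ((1 + x) / 2))\<^sup>2 + (x + 1) / 3 * (f (x / 2) * (1 - f ((1 + x) / 2)))"
    and a: "0 \<le> a" and le: "\<And>x. 0 \<le> x \<Longrightarrow> x \<le> 1 \<Longrightarrow> f x \<le> exp (a * (x - 1))"
    and x: "0 \<le> x" "x \<le> 1"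
  shows "f x \<le> exp ((a + exp (- a / 2) / 6) * (x - 1))"
proof -
  define u v \<alpha> \<beta> where "u = f (x / 2)" and "v = f ((1 + x) / 2)"
    and "\<alpha> = exp (a * (x / 2 - 1))" and "\<beta> = exp (a * ((1 + x) / 2 - 1))"
  have uv: "0 \<le> u" "u \<le> v" "v \<le> \<beta>" "u \<le> \<alpha>" "v \<le> 1"
    using x f01[of "x / 2"] f01[of "(1 + x) / 2"] mono[of "x / 2" "(1 + x) / 2"] le[of "x / 2"] le[of "(1 + x) / 2"]
    by (auto simp: u_def v_def \<alpha>_def \<beta>_def)
  have "a * ((1 + x) / 2 - 1) \<le> 0" using a x by (intro mult_nonneg_nonpos) auto
  then have \<beta>1: "\<beta> \<le> 1" by (simp add: \<beta>_def)
  \<comment> \<open>Monotonicity in \<open>v\<close> uses \<open>u \<le> v\<close>, that is, that \<open>f\<close> is increasing.\<close>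
  have "0 \<le> (\<beta> - v) * ((x + 2) * (\<beta> + v) - (x + 1) * u)"
  proof (intro mult_nonneg_nonneg)
    have "(x + 1) * u \<le> (x + 2) * v" using uv x by (intro mult_mono) auto
    also have "\<dots> \<le> (x + 2) * (\<beta> + v)" using uv x by (intro mult_left_mono) auto
    finally show "0 \<le> (x + 2) * (\<beta> + v) - (x + 1) * u" by simp
  qed (use uv in simp)
  then have "(x + 2) * v\<^sup>2 + (x + 1) * (u * (1 - v)) \<le> (x + 2) * \<beta>\<^sup>2 + (x + 1) * (u * (1 - \<beta>))"
    by (simp add: algebra_simps power2_eq_square)
  also have "\<dots> \<le> (x + 2) * \<beta>\<^sup>2 + (x + 1) * (\<alpha> * (1 - \<beta>))"
    using uv x \<beta>1 by (intro add_left_mono mult_left_mono mult_right_mono) auto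
  finally have 1: "f x \<le> ((x + 2) * \<beta>\<^sup>2 + (x + 1) * (\<alpha> * (1 - \<beta>))) / 3"
    using rec[OF x] by (simp add: u_def v_def field_simps)
  define b s where "b = a / 2" and "s = 1 - x"
  have \<beta>: "\<beta> = exp (- (b * s))" by (simp add: \<beta>_def b_def s_def field_simps)
  have \<alpha>: "\<alpha> = exp (- (2 * b * s)) * (exp (- b) * exp (b * s))"
    unfolding exp_add[symmetric] \<alpha>_def by (simp add: b_def s_def field_simps)
  have \<beta>2: "\<beta>\<^sup>2 = exp (- (2 * b * s))"
    unfolding \<beta> power2_eq_square exp_add[symmetric] by simp
  have \<alpha>\<beta>: "\<alpha> * (1 - \<beta>) = \<beta>\<^sup>2 * (exp (- b) * (exp (b * s) - 1))"
  proof -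
    have "exp (b * s) * \<beta> = 1" unfolding \<beta> exp_add[symmetric] by simp
    then have "exp (b * s) * (1 - \<beta>) = exp (b * s) - 1" by (simp add: algebra_simps)
    then show ?thesis unfolding \<alpha> \<beta>2[symmetric] by (simp only: mult.assoc)
  qed
  have "(2 - s) * (exp (b * s) - 1) \<le> s * (exp b - 1 / 2)"
    by (rule exp_improvement) (use a x in \<open>auto simp: b_def s_def\<close>)
  then have "exp (- b) * ((2 - s) * (exp (b * s) - 1)) \<le> exp (- b) * (s * (exp b - 1 / 2))"
    by (rule mult_left_mono) simp
  also have "\<dots> = s - s * exp (- b) / 2" by (simp add: algebra_simps exp_minus field_simps)
  finally have 2: "(x + 1) * (exp (- b) * (exp (b * s) - 1)) \<le> s - s * exp (- b) / 2"
    by (simp add: s_def algebra_simps)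
  have "((x + 2) * \<beta>\<^sup>2 + (x + 1) * (\<alpha> * (1 - \<beta>))) / 3
      = \<beta>\<^sup>2 * ((x + 2) + (x + 1) * (exp (- b) * (exp (b * s) - 1))) / 3"
    unfolding \<alpha>\<beta> by (simp add: algebra_simps)
  also have "\<dots> \<le> \<beta>\<^sup>2 * ((x + 2) + (s - s * exp (- b) / 2)) / 3"
    using 2 by (intro divide_right_mono mult_left_mono add_left_mono) auto
  also have "\<dots> = \<beta>\<^sup>2 * (1 + - (s * exp (- b) / 6))" by (simp add: s_def field_simps)
  also have "\<dots> \<le> \<beta>\<^sup>2 * exp (- (s * exp (- b) / 6))"
    by (intro mult_left_mono exp_ge_add_one_self) simp
  also have "\<dots> = exp ((a + exp (- a / 2) / 6) * (x - 1))"
    unfolding \<beta>2 exp_add[symmetric] by (simp add: b_def s_def algebra_simps diff_divide_distrib)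
  finally show ?thesis using 1 by simp
qed

text \<open>
  Were \<open>f x\<close> positive for some \<open>x < 1\<close>, the exponents \<open>a\<close> that give a valid bound would have a finite
  supremum.  But near the supremum the exponent can be increased by a fixed amount.
\<close>

lemma recursion_forces_zero:
  fixes f :: "real \<Rightarrow> real"
  assumes f01: "\<And>x. 0 \<le> x \<Longrightarrow> x \<le> 1 \<Longrightarrow> 0 \<le> f x \<and> f x \<le> 1"
    and mono: "\<And>x y. 0 \<le> x \<Longrightarrow> x \<le> y \<Longrightarrow> y \<le> 1 \<Longrightarrow> f x \<le> f y"
    and rec: "\<And>x. 0 \<le> x \<Longrightarrow> x \<le> 1 \<Longrightarrow>
      f x \<le> (x + 2) / 3 * (f ((1 + x) / 2))\<^sup>2 + (x + 1) / 3 * (f (x / 2) * (1 - f ((1 + x) / 2)))"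
    and x: "0 \<le> x" "x < 1"
  shows "f x = 0"
proof (rule ccontr)
  assume "f x \<noteq> 0"
  then have pos: "0 < f x" using f01[of x] x by auto
  define S where "S = {a. 0 \<le> a \<and> (\<forall>x. 0 \<le> x \<longrightarrow> x \<le> 1 \<longrightarrow> f x \<le> exp (a * (x - 1)))}"
  have ne: "0 \<in> S" using f01 by (simp add: S_def)
  have bound: "a \<le> ln (f x) / (x - 1)" if "a \<in> S" for a
  proof -
    have "f x \<le> exp (a * (x - 1))" using that x by (simp add: S_def)
    then have "ln (f x) \<le> a * (x - 1)" using pos by (metis ln_exp ln_le_cancel_iff exp_gt_zero)
    then show ?thesis using x by (simp add: field_simps)
  qed
  then have bdd: "bdd_above S" by (rule bdd_aboveI)
  define \<epsilon> where "\<epsilon> = exp (- Sup S / 2) / 6"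
  have "0 < \<epsilon>" by (simp add: \<epsilon>_def)
  then obtain a where a: "a \<in> S" "Sup S - \<epsilon> < a"
    using less_cSup_iff[of S "Sup S - \<epsilon>"] ne bdd by auto
  have "a \<le> Sup S" using a(1) bdd by (rule cSup_upper)
  then have "\<epsilon> \<le> exp (- a / 2) / 6" by (simp add: \<epsilon>_def)
  have "a + exp (- a / 2) / 6 \<in> S"
    using a(1) exp_bound_improves[OF f01 mono rec, of a] unfolding S_def by (auto simp: add_nonneg_nonneg)
  then have "a + exp (- a / 2) / 6 \<le> Sup S" using bdd by (rule cSup_upper)
  then show False using a(2) \<open>\<epsilon> \<le> exp (- a / 2) / 6\<close> by simp
qed

context frog_tie
begin

lemma \<phi>_tendsto_0:
  assumes x: "0 \<le> x" "x < 1"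
  shows "(\<lambda>t. \<phi> t x) \<longlonglongrightarrow> 0"
proof -
  define f where "f z = lim (\<lambda>t. \<phi> t z)" for z
  have f: "(\<lambda>t. \<phi> t z) \<longlonglongrightarrow> f z" if "0 \<le> z" "z \<le> 1" for z
  proof -
    have "decseq (\<lambda>t. \<phi> t z)" using \<phi>_decreasing[OF that] by (simp add: decseq_def)
    moreover have "\<forall>t. 0 \<le> \<phi> t z" using \<phi>_bounds(1)[OF that] by simp
    ultimately have "convergent (\<lambda>t. \<phi> t z)" using decseq_convergent convergent_def by metis
    then show ?thesis unfolding f_def by (rule convergent_LIMSEQ_iff[THEN iffD1])
  qed
  have "f x = 0"
  proof (rule recursion_forces_zero[of f])
    fix z :: real assume z: "0 \<le> z" "z \<le> 1"
    show "0 \<le> f z \<and> f z \<le> 1"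
      using LIMSEQ_le_const[OF f[OF z]] LIMSEQ_le_const2[OF f[OF z]] \<phi>_bounds[OF z] by blast
  next
    fix z z' :: real assume z: "0 \<le> z" "z \<le> z'" "z' \<le> 1"
    have "0 \<le> z'" "z \<le> 1" using z by auto
    then show "f z \<le> f z'"
      using LIMSEQ_le[OF f f] \<phi>_mono[OF z] z by blast
  next
    fix z :: real assume z: "0 \<le> z" "z \<le> 1"
    let ?y = "(1 + z) / 2"
    have y: "0 \<le> ?y" "?y \<le> 1" "0 \<le> z / 2" "z / 2 \<le> 1" using z by auto
    define b where "b = f (z / 2) * (1 - f ?y) + (f ?y)\<^sup>2"
    have "(\<lambda>t. \<phi> (2 * t + 3) z) \<longlonglongrightarrow> f z"
      using LIMSEQ_subseq_LIMSEQ[OF f[OF z], of "\<lambda>t. 2 * t + 3"] by (simp add: strict_mono_def comp_def)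
    moreover have "(\<lambda>t. (p * z + (1 - p) / d) * (\<phi> t (z / 2) * (1 - \<phi> t ?y) + (\<phi> t ?y)\<^sup>2) + p * (\<phi> t ?y)\<^sup>2)
        \<longlonglongrightarrow> (p * z + (1 - p) / d) * b + p * (f ?y)\<^sup>2"
      unfolding b_def by (intro tendsto_intros f y)
    ultimately have 1: "f z \<le> (p * z + (1 - p) / d) * b + p * (f ?y)\<^sup>2"
      by (rule LIMSEQ_le) (use \<phi>_recursion[OF z] in blast)
    have lim01: "0 \<le> f w" "f w \<le> 1" if "0 \<le> w" "w \<le> 1" for w
      using LIMSEQ_le_const[OF f[OF that]] LIMSEQ_le_const2[OF f[OF that]] \<phi>_bounds[OF that] by blast+
    have b: "(f ?y)\<^sup>2 \<le> b" using lim01[OF y(1,2)] lim01[OF y(3,4)] by (simp add: b_def)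
    \<comment> \<open>The right-hand side is decreasing in \<open>p\<close>, because \<open>b\<close> dominates \<open>(f y)^2\<close>; compare with \<open>p = 1/3\<close>.\<close>
    have pd: "(1 - p) / d = 1 - 2 * p" using p_bounds(4) by simp
    have "(p * z + (1 - p) / d) * b + p * (f ?y)\<^sup>2
        = (z + 1) / 3 * b + (f ?y)\<^sup>2 / 3 + (p - 1 / 3) * ((f ?y)\<^sup>2 - (2 - z) * b)"
      unfolding pd by (simp add: field_simps)
    also have "(p - 1 / 3) * ((f ?y)\<^sup>2 - (2 - z) * b) \<le> 0"
    proof (rule mult_nonneg_nonpos)
      have "1 * b \<le> (2 - z) * b" using b z by (intro mult_right_mono) (auto intro: order_trans[OF zero_le_power2])
      then show "(f ?y)\<^sup>2 - (2 - z) * b \<le> 0" using b by simp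
    qed (use p_bounds(5) in simp)
    finally have "f z \<le> (z + 1) / 3 * b + (f ?y)\<^sup>2 / 3" using 1 by simp
    also have "\<dots> = (z + 2) / 3 * (f ?y)\<^sup>2 + (z + 1) / 3 * (f (z / 2) * (1 - f ?y))"
      by (simp add: b_def field_simps)
    finally show "f z \<le> (z + 2) / 3 * (f ?y)\<^sup>2 + (z + 1) / 3 * (f (z / 2) * (1 - f ?y))" .
  qed (use x in auto)
  then show ?thesis using f[of x] x by simp
qed

text \<open>
  Markov's inequality for \<open>(1/2) ^ card\<close>: few returns at all times are impossible since the
  generating function at \<open>1/2\<close> tends to \<open>0\<close>.
\<close>

lemma AE_returns_unbounded:
  assumes h: "entry_history c h"
  shows "AE \<omega> in \<mu>. \<exists>t. n < card (returns c h \<omega> t)"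
proof -
  define A where "A t = {\<omega>. card (returns c h \<omega> t) \<le> n}" for t
  have fd: "finitely_determined (\<lambda>\<omega>. card (returns c h \<omega> t) \<le> n)" for t
    by (rule finitely_determined_comp[OF finitely_determined_returns])
  have A: "A t \<in> sets \<mu>" for t unfolding A_def by (rule W.sets_finitely_determined[OF fd])
  have le: "W.law.prob (\<Inter>t. A t) \<le> 2 ^ n * \<phi> t (1 / 2)" for t
  proof -
    have "(1 / 2) ^ n * W.law.prob (A t) = (\<integral>\<omega>. (1 / 2) ^ n * indicator (A t) \<omega> \<partial>\<mu>)"
      using A by simp
    also have "\<dots> \<le> (\<integral>\<omega>. (1 / 2) ^ card (returns c h \<omega> t) \<partial>\<mu>)"
    proof (rule integral_mono)
      show "integrable \<mu> (\<lambda>\<omega>. (1 / 2) ^ n * indicator (A t) \<omega> :: real)"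
        using A by (auto simp: integrable_indicator_iff W.law.emeasure_eq_measure)
      show "integrable \<mu> (\<lambda>\<omega>. (1 / 2) ^ card (returns c h \<omega> t) :: real)"
        by (rule expectation_bounds(3)[OF fd_returns_power]) (auto simp: power_le_one)
      show "(1 / 2) ^ n * indicator (A t) \<omega> \<le> ((1 / 2) ^ card (returns c h \<omega> t) :: real)" for \<omega>
        by (auto simp: A_def indicator_def intro!: power_decreasing)
    qed
    also have "\<dots> \<le> \<phi> t (1 / 2)" by (rule \<phi>_upper[OF h]) auto
    finally have "W.law.prob (A t) \<le> 2 ^ n * \<phi> t (1 / 2)" by (simp add: field_simps power_divide)
    moreover have "W.law.prob (\<Inter>t. A t) \<le> W.law.prob (A t)"
      using A by (intro W.law.finite_measure_mono) auto
    ultimately show ?thesis by simp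
  qed
  have "(\<lambda>t. 2 ^ n * \<phi> t (1 / 2)) \<longlonglongrightarrow> 2 ^ n * 0"
    by (intro tendsto_mult_left \<phi>_tendsto_0) auto
  then have "W.law.prob (\<Inter>t. A t) \<le> 2 ^ n * 0"
    by (rule LIMSEQ_le_const) (use le in blast)
  then have "W.law.prob (\<Inter>t. A t) = 0" using measure_nonneg[of \<mu> "\<Inter>t. A t"] by linarith
  then have "AE \<omega> in \<mu>. \<omega> \<notin> (\<Inter>t. A t)"
    using A W.law.prob_eq_0[of "\<Inter>t. A t"] by (simp add: sets.countable_INT')
  then show ?thesis by eventually_elim (auto simp: A_def not_le)
qed

text \<open>
  After its first step the whole process is the process in the subtree of the child \<open>[i]\<close> of the root
  that the first frog chose.  Returns to the parent of \<open>[i]\<close> are visits to the root.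
\<close>

lemma SFM_first_step:
  assumes "\<omega> [[]] = [i]"
  shows "agree_on [i] (SFM d tie \<omega> (Suc 0)) (start [i] [[]])"
proof -
  let ?s = "\<lambda>f. if f = [] then Active [[]] else Asleep"
  have j: "jumping \<omega> ?s f u v \<longleftrightarrow> f = [] \<and> u = [] \<and> v = [i]" for f u v
    using assms by (auto simp: jumps_def attempts_def)
  have s: "SFM d tie \<omega> (Suc 0) f =
      (if f = [] then Active [[i], []] else if f = [i] then Active [[i]] else Asleep)" for f
    using assms by (auto simp: SFM_step_def j)
  have "[] \<notin> subtree [i]" using parent_notin_subtree[of "[i]"] by simp
  then show ?thesis
    unfolding agree_on_def s start_def by auto
qed

lemma returns_are_root_visits:
  assumes nb: "to_neighbours d \<omega>" and i: "\<omega> [[]] = [i]"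
  shows "returns [i] [[]] \<omega> t \<subseteq> (\<lambda>(f, t). THE h. SFM d tie \<omega> t f = Active h) ` root_visits d tie \<omega>"
proof
  have ag: "agree_on [i] (SFM d tie \<omega> (Suc t)) (run [i] [[]] \<omega> t)" for t
  proof (induction t)
    case 0
    then show ?case using SFM_first_step[of \<omega> i, OF i] by simp
  next
    case (Suc t)
    then show ?case using agree_on_step(1)[OF Suc nb] by simp
  qed
  fix h' assume "h' \<in> returns [i] [[]] \<omega> t"
  then obtain s f r where s: "run [i] [[]] \<omega> s f = Active h'" "h' = [] # [i] # r"
    unfolding returns_def by auto
  have "SFM d tie \<omega> (Suc s) f = Active h'"
  proof (cases s)
    case 0
    then show ?thesis using s by (auto simp: start_def split: if_splits)
  next
    case (Suc s')
    then show ?thesis using agree_on_step(2)[OF ag[of s'] nb, of f h'] s(1) by simp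
  qed
  then show "h' \<in> (\<lambda>(f, t). THE h. SFM d tie \<omega> t f = Active h) ` root_visits d tie \<omega>"
    using s(2) by (intro image_eqI[of _ _ "(f, Suc s)"]) (auto simp: root_visits_def)
qed

lemma AE_infinite_root_visits: "AE \<omega> in frog_space d p. infinite (root_visits d tie \<omega>)"
proof -
  have eh: "entry_history [i] [[]]" for i
    unfolding entry_history_def using parent_notin_subtree[of "[i]"] by auto
  have "AE \<omega> in \<mu>. \<forall>i n. \<exists>t. n < card (returns [i] [[]] \<omega> t)"
    unfolding AE_all_countable using AE_returns_unbounded[OF eh] by blast
  then show ?thesis
    unfolding frog_space_eq using AE_legal
  proof eventually_elim
    case (elim \<omega>)
    have "\<omega> [[]] \<in> set_pmf (next_site d p [[]])" using elim(2) unfolding legal_def by blast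
    then have "\<omega> [[]] \<in> children d []" by simp
    then obtain i where i: "\<omega> [[]] = [i]" by (auto simp: children_iff)
    show ?case
    proof
      assume fin: "finite (root_visits d tie \<omega>)"
      let ?V = "(\<lambda>(f, t). THE h. SFM d tie \<omega> t f = Active h) ` root_visits d tie \<omega>"
      obtain t where "card ?V < card (returns [i] [[]] \<omega> t)" using elim(1) by blast
      moreover have "card (returns [i] [[]] \<omega> t) \<le> card ?V"
        by (rule card_mono[OF finite_imageI[OF fin] returns_are_root_visits[OF legal_to_neighbours[OF elim(2)] i]])
      ultimately show False by simp
    qed
  qed
qed

end

theorem proposition1p5:
  fixes d :: nat
  assumes "d \<ge> 2"
  shows "SFM_recurrent d ((real d - 1) / (2 * real d - 1))"
  unfolding SFM_recurrent_def
proof (intro allI impI)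
  fix tie assume "tie_rule tie"
  then interpret frog_tie d tie using assms by unfold_locales
  show "AE \<omega> in frog_space d ((real d - 1) / (2 * real d - 1)). infinite (root_visits d tie \<omega>)"
    using AE_infinite_root_visits unfolding p_def .
qed

end
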